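(* There exists an infinite simple group which is sharply 2-transitive, i.e. which acts sharply 2-transitively on some set.
   Context: An action of a group $G$ on a set $X$ with $|X|\geq 2$ is called sharply 2-transitive if for any two pairs $(x_1,x_2)$ and $(y_1,y_2)$ of elements of $X$ with $x_1\neq x_2$ and $y_1\neq y_2$ there exists a unique $g\in G$ such that $g\cdot x_1=y_1$ and $g\cdot x_2=y_2$. A group is called sharply 2-transitive if it acts sharply 2-transitively on some set $X$ with $|X|\geq 2$. *)

theory Defs
  imports "HOL-Algebra.Group_Action" "HOL-Algebra.SimpleGroups" "HOL-Algebra.Generated_Groups"
    "HOL-Library.Countable_Set"
begin

text \<open>
  The library locale \<^locale>\<open>simple_group\<close> cannot be used for infinite groups: it
  assumes \<open>order G > 1\<close>, and the order of an infinite group is \<open>0\<close> because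
  \<^const>\<open>card\<close> vanishes on infinite sets. The definition below is the same notion
  with non-triviality stated in a way that makes sense for every group.
\<close>

definition is_simple_group :: "('a, 'm) monoid_scheme \<Rightarrow> bool" where
  "is_simple_group G \<longleftrightarrow>
     group G \<and> carrier G \<noteq> {\<one>\<^bsub>G\<^esub>} \<and>
     (\<forall>H. H \<lhd> G \<longrightarrow> H = carrier G \<or> H = {\<one>\<^bsub>G\<^esub>})"

lemma simple_group_iff_is_simple_group:
  assumes "finite (carrier G)"
  shows "simple_group G \<longleftrightarrow> is_simple_group G"
proof -
  have "order G > 1 \<longleftrightarrow> carrier G \<noteq> {\<one>\<^bsub>G\<^esub>}" if "group G"
  proof -
    interpret group G by fact
    have "order G > 0" using assms by (simp add: order_gt_0_iff_finite)
    moreover have "order G = 1 \<longleftrightarrow> carrier G = {\<one>\<^bsub>G\<^esub>}"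
      by (metis card_1_singletonE is_singletonI is_singleton_altdef one_closed order_def singletonD)
    ultimately show ?thesis by linarith
  qed
  then show ?thesis
    by (auto simp: simple_group_def simple_group_axioms_def is_simple_group_def)
qed

text \<open>
  The condition \<open>|X| \<ge> 2\<close> is phrased by two distinct points, so that infinite \<open>X\<close>
  are covered.
\<close>

locale sharply_2_transitive_action = group_action G X \<phi>
  for G :: "('a, 'm) monoid_scheme" (structure)
    and X :: "'b set" and \<phi> :: "'a \<Rightarrow> 'b \<Rightarrow> 'b" +
  assumes two_points: "\<exists>x\<in>X. \<exists>y\<in>X. x \<noteq> y"
    and sharply_2_transitive:
      "\<lbrakk> x1 \<in> X; x2 \<in> X; y1 \<in> X; y2 \<in> X; x1 \<noteq> x2; y1 \<noteq> y2 \<rbrakk>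
        \<Longrightarrow> \<exists>!g. g \<in> carrier G \<and> \<phi> g x1 = y1 \<and> \<phi> g x2 = y2"

text \<open>
  A definition cannot quantify over the type of the points. Taking the points in the
  type of the group elements loses nothing: a set with a sharply 2-transitive action of
  \<open>G\<close> always injects into \<open>G\<close>, see \<open>sharply_2_transitive_groupI\<close> below.
\<close>

definition sharply_2_transitive_group :: "('a, 'm) monoid_scheme \<Rightarrow> bool" where
  "sharply_2_transitive_group G \<longleftrightarrow>
     (\<exists>(X :: 'a set) \<phi>. sharply_2_transitive_action G X \<phi>)"

lemma sharply_2_transitive_groupI:
  fixes G :: "('a, 'm) monoid_scheme" and X :: "'b set"
  assumes "sharply_2_transitive_action G X \<phi>"
  shows "sharply_2_transitive_group G"
proof -
  interpret sharply_2_transitive_action G X \<phi> by fact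
  interpret gh: group_hom G "BijGroup X" \<phi> by (rule group_hom)
  obtain p q where pq: "p \<in> X" "q \<in> X" "p \<noteq> q" using two_points by blast
  have "\<exists>g\<in>carrier G. \<phi> g p = y" if "y \<in> X" for y
  proof -
    obtain z where "z \<in> X" "z \<noteq> y" using pq by metis
    then show ?thesis using sharply_2_transitive[of p q y z] pq that by blast
  qed
  then obtain f where f: "\<And>y. y \<in> X \<Longrightarrow> f y \<in> carrier G \<and> \<phi> (f y) p = y"
    by metis
  have inj: "inj_on f X" by (rule inj_onI) (metis f)
  define Y where "Y = f ` X"
  define h where "h = the_inv_into X f"
  have hf: "h (f x) = x" if "x \<in> X" for x
    using inj that by (simp add: h_def the_inv_into_f_f)
  have hY: "h y \<in> X" "f (h y) = y" if "y \<in> Y" for y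
    using that hf by (auto simp: Y_def)
  have h_eq: "h y = h z \<longleftrightarrow> y = z" if "y \<in> Y" "z \<in> Y" for y z
    using hY that by metis
  define \<psi> where "\<psi> = (\<lambda>g. \<lambda>y\<in>Y. f (\<phi> g (h y)))"
  have act: "\<phi> g x \<in> X" if "g \<in> carrier G" "x \<in> X" for g x
    using element_image that by blast
  have bij: "bij_betw (\<phi> g) X X" if "g \<in> carrier G" for g
    using gh.hom_closed[OF that] by (simp add: BijGroup_def Bij_def)
  have fXY: "bij_betw f X Y" using inj by (simp add: Y_def bij_betw_def)
  have hYX: "bij_betw h Y X" unfolding h_def by (rule bij_betw_the_inv_into[OF fXY])
  have \<psi>_Bij: "\<psi> g \<in> Bij Y" if "g \<in> carrier G" for g
  proof -
    have "bij_betw (f \<circ> (\<phi> g \<circ> h)) Y Y"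
      by (intro bij_betw_trans[OF bij_betw_trans[OF hYX bij[OF that]] fXY])
    moreover have "bij_betw (\<psi> g) Y Y \<longleftrightarrow> bij_betw (f \<circ> (\<phi> g \<circ> h)) Y Y"
      by (rule bij_betw_cong) (simp add: \<psi>_def)
    ultimately show ?thesis by (simp add: Bij_def \<psi>_def)
  qed
  have \<psi>_mult: "\<psi> (a \<otimes>\<^bsub>G\<^esub> b) = compose Y (\<psi> a) (\<psi> b)"
    if "a \<in> carrier G" "b \<in> carrier G" for a b
  proof
    fix y
    show "\<psi> (a \<otimes>\<^bsub>G\<^esub> b) y = compose Y (\<psi> a) (\<psi> b) y"
    proof (cases "y \<in> Y")
      case True
      have "f (\<phi> b (h y)) \<in> Y" using act hY True that by (simp add: Y_def)
      then show ?thesis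
        using True that hY act hf composition_rule[of "h y" a b]
        by (simp add: \<psi>_def compose_def)
    qed (simp add: \<psi>_def compose_def)
  qed
  have "group_action G Y \<psi>"
    unfolding group_action_def group_hom_def group_hom_axioms_def hom_def
    using gh.G.is_group group_BijGroup[of Y] \<psi>_Bij \<psi>_mult
    by (auto simp: BijGroup_def)
  moreover have "\<exists>x\<in>Y. \<exists>y\<in>Y. x \<noteq> y"
    using pq inj by (auto simp: Y_def inj_on_eq_iff)
  moreover have "\<exists>!g. g \<in> carrier G \<and> \<psi> g x1 = y1 \<and> \<psi> g x2 = y2"
    if Y: "x1 \<in> Y" "x2 \<in> Y" "y1 \<in> Y" "y2 \<in> Y" and ne: "x1 \<noteq> x2" "y1 \<noteq> y2" for x1 x2 y1 y2
  proof -
    have iff: "\<psi> g x = y \<longleftrightarrow> \<phi> g (h x) = h y" if "g \<in> carrier G" "x \<in> Y" "y \<in> Y" for g x y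
      using that act hY hf by (auto simp: \<psi>_def)
    have "\<exists>!g. g \<in> carrier G \<and> \<phi> g (h x1) = h y1 \<and> \<phi> g (h x2) = h y2"
      using Y ne hY h_eq by (intro sharply_2_transitive) auto
    then show ?thesis
      using iff Y by metis
  qed
  ultimately have "sharply_2_transitive_action G Y \<psi>"
    by (simp add: sharply_2_transitive_action_def sharply_2_transitive_action_axioms_def)
  then show ?thesis unfolding sharply_2_transitive_group_def by blast
qed

text \<open>
  Nor can a statement quantify over the type of the group elements. The rest of this
  theory shows, by a downward Loewenheim-Skolem argument, that whenever a type contains
  the carrier of an infinite simple sharply 2-transitive group, so does \<^typ>\<open>nat\<close>.
\<close>

lemma is_simple_group_iso:
  assumes G: "is_simple_group G" and H: "group H" and iso: "h \<in> iso H G"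
  shows "is_simple_group H"
proof -
  interpret G: group G using G by (simp add: is_simple_group_def)
  interpret H: group H by (rule H)
  have bij: "bij_betw h (carrier H) (carrier G)" and hom: "h \<in> hom H G"
    using iso by (auto simp: iso_def)
  interpret gh: group_hom H G h
    using hom by unfold_locales
  have img1: "h ` {\<one>\<^bsub>H\<^esub>} = {\<one>\<^bsub>G\<^esub>}" by simp
  have surj: "h ` carrier H = carrier G" using bij by (simp add: bij_betw_def)
  have eq: "A = B" if "h ` A = h ` B" "A \<subseteq> carrier H" "B \<subseteq> carrier H" for A B
    using that bij by (metis bij_betw_def inj_on_image_eq_iff)
  have "carrier H \<noteq> {\<one>\<^bsub>H\<^esub>}"
    using G surj img1 by (metis is_simple_group_def)
  moreover have "N = carrier H \<or> N = {\<one>\<^bsub>H\<^esub>}" if N: "N \<lhd> H" for N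
  proof -
    have sub: "N \<subseteq> carrier H" using N by (simp add: normal_imp_subgroup subgroup.subset)
    have "h ` N \<lhd> G" using iso_normal_subgroup[OF iso H G.is_group N] .
    then have "h ` N = carrier G \<or> h ` N = {\<one>\<^bsub>G\<^esub>}"
      using G by (auto simp: is_simple_group_def)
    then show ?thesis using eq[of N "carrier H"] eq[of N "{\<one>\<^bsub>H\<^esub>}"] surj img1 sub by auto
  qed
  ultimately show ?thesis using H by (simp add: is_simple_group_def)
qed

lemma sharply_2_transitive_action_iso:
  assumes act: "sharply_2_transitive_action G Y \<phi>" and H: "group H" and iso: "h \<in> iso H G"
  shows "sharply_2_transitive_action H Y (\<phi> \<circ> h)"
proof -
  interpret sharply_2_transitive_action G Y \<phi> by (rule act)
  interpret gh: group_hom G "BijGroup Y" \<phi> by (rule group_hom)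
  have bij: "bij_betw h (carrier H) (carrier G)" and hom: "h \<in> hom H G"
    using iso by (auto simp: iso_def)
  have "\<phi> \<circ> h \<in> hom H (BijGroup Y)"
    using hom gh.homh by (auto simp: hom_def Pi_iff)
  then have "group_action H Y (\<phi> \<circ> h)"
    using H group_BijGroup by (simp add: group_action_def group_hom_def group_hom_axioms_def)
  moreover have "\<exists>!g. g \<in> carrier H \<and> (\<phi> \<circ> h) g x1 = y1 \<and> (\<phi> \<circ> h) g x2 = y2"
    if "x1 \<in> Y" "x2 \<in> Y" "y1 \<in> Y" "y2 \<in> Y" "x1 \<noteq> x2" "y1 \<noteq> y2" for x1 x2 y1 y2
  proof -
    from sharply_2_transitive[OF that] obtain g where
      g: "g \<in> carrier G" "\<phi> g x1 = y1" "\<phi> g x2 = y2" and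
      u: "\<And>g'. g' \<in> carrier G \<Longrightarrow> \<phi> g' x1 = y1 \<Longrightarrow> \<phi> g' x2 = y2 \<Longrightarrow> g' = g" by metis
    obtain g0 where g0: "g0 \<in> carrier H" "h g0 = g"
      using bij g(1) by (metis bij_betw_def imageE)
    show ?thesis
    proof (rule ex1I[of _ g0])
      show "g0 \<in> carrier H \<and> (\<phi> \<circ> h) g0 x1 = y1 \<and> (\<phi> \<circ> h) g0 x2 = y2"
        using g g0 by simp
    next
      fix g' assume g': "g' \<in> carrier H \<and> (\<phi> \<circ> h) g' x1 = y1 \<and> (\<phi> \<circ> h) g' x2 = y2"
      then have "h g' \<in> carrier G" using bij by (metis bij_betwE)
      then have "h g' = h g0" using g' g0 u by simp
      then show "g' = g0" using g' g0 bij by (metis bij_betw_def inj_on_eq_iff)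
    qed
  qed
  ultimately show ?thesis
    using two_points
    by (simp add: sharply_2_transitive_action_def sharply_2_transitive_action_axioms_def)
qed

lemma simple_group_countable_witness:
  assumes G: "is_simple_group G" and a: "a \<in> carrier G" "a \<noteq> \<one>\<^bsub>G\<^esub>" and b: "b \<in> carrier G"
  shows "\<exists>D :: nat \<Rightarrow> 'a. range D \<subseteq> carrier G \<and>
           b \<in> generate G ((\<lambda>g. g \<otimes>\<^bsub>G\<^esub> a \<otimes>\<^bsub>G\<^esub> inv\<^bsub>G\<^esub> g) ` range D)"
proof -
  interpret group G using G by (simp add: is_simple_group_def)
  define c where "c = (\<lambda>g. g \<otimes>\<^bsub>G\<^esub> a \<otimes>\<^bsub>G\<^esub> inv\<^bsub>G\<^esub> g)"
  have c_closed: "c g \<in> carrier G" if "g \<in> carrier G" for g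
    using that a by (simp add: c_def)
  have "generate G (c ` carrier G) \<lhd> G"
  proof (rule normal_generateI)
    show "c ` carrier G \<subseteq> carrier G" using c_closed by auto
    fix x g assume "x \<in> c ` carrier G" and g: "g \<in> carrier G"
    then obtain k where k: "k \<in> carrier G" "x = c k" by auto
    have "g \<otimes>\<^bsub>G\<^esub> x \<otimes>\<^bsub>G\<^esub> inv\<^bsub>G\<^esub> g = c (g \<otimes>\<^bsub>G\<^esub> k)"
      using k g a by (simp add: c_def m_assoc inv_mult_group)
    then show "g \<otimes>\<^bsub>G\<^esub> x \<otimes>\<^bsub>G\<^esub> inv\<^bsub>G\<^esub> g \<in> c ` carrier G" using g k by simp
  qed
  moreover have "a \<in> generate G (c ` carrier G)"
  proof -
    have "a = c \<one>\<^bsub>G\<^esub>" using a by (simp add: c_def)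
    then show ?thesis by (metis generate.incl imageI one_closed)
  qed
  ultimately have "generate G (c ` carrier G) = carrier G"
    using G a by (auto simp: is_simple_group_def)
  then have "b \<in> generate G (c ` carrier G)" using b by simp
  then have "\<exists>C. countable C \<and> C \<subseteq> carrier G \<and> C \<noteq> {} \<and> b \<in> generate G (c ` C)"
  proof induction
    case one
    show ?case by (rule exI[of _ "{\<one>\<^bsub>G\<^esub>}"]) (auto intro: generate.one)
  next
    case (incl x)
    then obtain k where "k \<in> carrier G" "x = c k" by auto
    then show ?case by (intro exI[of _ "{k}"]) (auto intro: generate.incl)
  next
    case (inv x)
    then obtain k where "k \<in> carrier G" "x = c k" by auto
    then show ?case by (intro exI[of _ "{k}"]) (auto intro: generate.inv)
  next
    case (eng x y)
    then obtain C D where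
      C: "countable C" "C \<subseteq> carrier G" "C \<noteq> {}" "x \<in> generate G (c ` C)" and
      D: "countable D" "D \<subseteq> carrier G" "D \<noteq> {}" "y \<in> generate G (c ` D)" by metis
    have "x \<in> generate G (c ` (C \<union> D))" "y \<in> generate G (c ` (C \<union> D))"
      using C(4) D(4) mono_generate[of "c ` C" "c ` (C \<union> D)"] mono_generate[of "c ` D" "c ` (C \<union> D)"]
      by auto
    then show ?case using C D by (intro exI[of _ "C \<union> D"]) (auto intro: generate.eng)
  qed
  then obtain C where C: "countable C" "C \<subseteq> carrier G" "C \<noteq> {}" "b \<in> generate G (c ` C)"
    by blast
  then have "range (from_nat_into C) = C" by (simp add: range_from_nat_into)
  then show ?thesis using C unfolding c_def by metis
qed

lemma countable_closure:
  fixes m :: "'a \<Rightarrow> 'a \<Rightarrow> 'a" and T :: "'a \<Rightarrow> 'a \<Rightarrow> 'a \<Rightarrow> 'a \<Rightarrow> 'a" and D :: "'a \<Rightarrow> 'a \<Rightarrow> nat \<Rightarrow> 'a"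
  assumes B: "countable B" "B \<subseteq> C"
    and m: "\<And>x y. x \<in> C \<Longrightarrow> y \<in> C \<Longrightarrow> m x y \<in> C" and i: "\<And>x. x \<in> C \<Longrightarrow> i x \<in> C"
    and T: "\<And>x y z w. \<lbrakk>x \<in> C; y \<in> C; z \<in> C; w \<in> C\<rbrakk> \<Longrightarrow> T x y z w \<in> C"
    and D: "\<And>x y n. x \<in> C \<Longrightarrow> y \<in> C \<Longrightarrow> D x y n \<in> C"
  obtains S where "countable S" "B \<subseteq> S" "S \<subseteq> C"
    "\<And>x y. x \<in> S \<Longrightarrow> y \<in> S \<Longrightarrow> m x y \<in> S" "\<And>x. x \<in> S \<Longrightarrow> i x \<in> S"
    "\<And>x y z w. \<lbrakk>x \<in> S; y \<in> S; z \<in> S; w \<in> S\<rbrakk> \<Longrightarrow> T x y z w \<in> S"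
    "\<And>x y n. x \<in> S \<Longrightarrow> y \<in> S \<Longrightarrow> D x y n \<in> S"
proof -
  define F where "F = (\<lambda>S. S \<union> (\<lambda>(x, y). m x y) ` (S \<times> S) \<union> i ` S
    \<union> (\<lambda>(x, y, z, w). T x y z w) ` (S \<times> S \<times> S \<times> S)
    \<union> (\<lambda>(x, y, n). D x y n) ` (S \<times> S \<times> UNIV))"
  define A where "A = (\<lambda>n. (F ^^ n) B)"
  define S where "S = (\<Union>n. A n)"
  have A0: "A 0 = B" and AS: "A (Suc n) = F (A n)" for n by (simp_all add: A_def)
  have "A n \<subseteq> A (Suc n)" for n unfolding AS F_def by blast
  then have mono: "A k \<subseteq> A n" if "k \<le> n" for k n
    using lift_Suc_mono_le[of A] that by blast
  have "countable (A n) \<and> A n \<subseteq> C" for n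
  proof (induction n)
    case 0
    then show ?case using B by (simp add: A0)
  next
    case (Suc n)
    then have "countable (A (Suc n))" unfolding AS F_def by (intro countable_Un countable_image countable_SIGMA) auto
    moreover have "A (Suc n) \<subseteq> C"
      using Suc m i T D unfolding AS F_def by (auto simp: subset_iff)
    ultimately show ?case by simp
  qed
  then have 1: "countable S" "S \<subseteq> C" by (auto simp: S_def)
  have step: "F (A n) \<subseteq> S" for n unfolding S_def by (metis AS UN_upper UNIV_I)
  have in_A: "\<exists>n. \<forall>z\<in>set zs. z \<in> A n" if "set zs \<subseteq> S" for zs
    using that
  proof (induction zs)
    case (Cons z zs)
    then obtain n k where "\<forall>z\<in>set zs. z \<in> A n" "z \<in> A k" by (auto simp: S_def)
    then have "\<forall>z\<in>set (z # zs). z \<in> A (max n k)"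
      using mono[of n "max n k"] mono[of k "max n k"] by auto
    then show ?case by blast
  qed simp
  show thesis
  proof (rule that[of S])
    show "countable S" "S \<subseteq> C" by fact+
    show "B \<subseteq> S" unfolding S_def using A0 by blast
    fix x y z w n assume x: "x \<in> S"
    then obtain k where "x \<in> A k" by (auto simp: S_def)
    then show "i x \<in> S" using step[of k] by (auto simp: F_def)
    assume y: "y \<in> S"
    from in_A[of "[x, y]"] x y obtain k where k: "x \<in> A k" "y \<in> A k" by auto
    have "m x y \<in> F (A k)" using k unfolding F_def by force
    then show "m x y \<in> S" using step[of k] by blast
    have "D x y n \<in> F (A k)" using k unfolding F_def by force
    then show "D x y n \<in> S" using step[of k] by blast
    assume z: "z \<in> S" and w: "w \<in> S"
    from in_A[of "[x, y, z, w]"] x y z w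
    obtain k where k: "x \<in> A k" "y \<in> A k" "z \<in> A k" "w \<in> A k" by auto
    have "T x y z w \<in> F (A k)" using k unfolding F_def by force
    then show "T x y z w \<in> S" using step[of k] by blast
  qed
qed

lemma countable_sharply_2_transitive_simple_subgroup:
  fixes G :: "('a, 'm) monoid_scheme" (structure)
  assumes inf: "infinite (carrier G)" and G: "is_simple_group G"
    and s2t: "sharply_2_transitive_action G Y \<phi>"
  obtains S Z \<psi> where "countable S" "infinite S" "subgroup S G"
    "is_simple_group (G\<lparr>carrier := S\<rparr>)"
    "sharply_2_transitive_action (G\<lparr>carrier := S\<rparr>) Z \<psi>" "Z \<subseteq> Y"
proof -
  interpret group G using G by (simp add: is_simple_group_def)
  interpret sharply_2_transitive_action G Y \<phi> by (rule s2t)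
  interpret gh: group_hom G "BijGroup Y" \<phi> by (rule group_hom)
  define D where "D = (\<lambda>a b. SOME d :: nat \<Rightarrow> 'a. range d \<subseteq> carrier G \<and>
    (a \<noteq> \<one> \<longrightarrow> b \<in> generate G ((\<lambda>g. g \<otimes> a \<otimes> inv g) ` range d)))"
  have D: "range (D a b) \<subseteq> carrier G \<and>
    (a \<noteq> \<one> \<longrightarrow> b \<in> generate G ((\<lambda>g. g \<otimes> a \<otimes> inv g) ` range (D a b)))"
    if "a \<in> carrier G" "b \<in> carrier G" for a b
  proof -
    have "\<exists>d :: nat \<Rightarrow> 'a. range d \<subseteq> carrier G \<and>
      (a \<noteq> \<one> \<longrightarrow> b \<in> generate G ((\<lambda>g. g \<otimes> a \<otimes> inv g) ` range d))"
    proof (cases "a = \<one>")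
      case True
      then show ?thesis by (intro exI[of _ "\<lambda>_. \<one>"]) auto
    next
      case False
      then show ?thesis
        using simple_group_countable_witness[OF G that(1) _ that(2)] by blast
    qed
    from someI_ex[OF this] show ?thesis unfolding D_def .
  qed
  obtain p q where pq: "p \<in> Y" "q \<in> Y" "p \<noteq> q" using two_points by blast
  have act: "\<phi> g x \<in> Y" if "g \<in> carrier G" "x \<in> Y" for g x
    using element_image that by blast
  obtain t where t: "t \<in> carrier G" "\<phi> t p = q"
    using sharply_2_transitive[of p q q p] pq by metis
  define T where "T = (\<lambda>a b c d. SOME g. g \<in> carrier G \<and>
     (\<phi> a p \<noteq> \<phi> b p \<and> \<phi> c p \<noteq> \<phi> d p \<longrightarrow> \<phi> g (\<phi> a p) = \<phi> c p \<and> \<phi> g (\<phi> b p) = \<phi> d p))"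
  have T: "T a b c d \<in> carrier G \<and>
     (\<phi> a p \<noteq> \<phi> b p \<and> \<phi> c p \<noteq> \<phi> d p \<longrightarrow>
       \<phi> (T a b c d) (\<phi> a p) = \<phi> c p \<and> \<phi> (T a b c d) (\<phi> b p) = \<phi> d p)"
    if "a \<in> carrier G" "b \<in> carrier G" "c \<in> carrier G" "d \<in> carrier G" for a b c d
  proof -
    have "\<exists>g. g \<in> carrier G \<and> (\<phi> a p \<noteq> \<phi> b p \<and> \<phi> c p \<noteq> \<phi> d p \<longrightarrow>
      \<phi> g (\<phi> a p) = \<phi> c p \<and> \<phi> g (\<phi> b p) = \<phi> d p)"
    proof (cases "\<phi> a p \<noteq> \<phi> b p \<and> \<phi> c p \<noteq> \<phi> d p")
      case True
      have "\<exists>!g. g \<in> carrier G \<and> \<phi> g (\<phi> a p) = \<phi> c p \<and> \<phi> g (\<phi> b p) = \<phi> d p"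
        by (rule sharply_2_transitive) (use True that act pq in auto)
      then show ?thesis by blast
    qed (use one_closed in blast)
    from someI_ex[OF this] show ?thesis unfolding T_def .
  qed
  obtain e :: "nat \<Rightarrow> 'a" where e: "inj e" "range e \<subseteq> carrier G"
    using infinite_countable_subset[OF inf] by blast
  have B: "countable (insert t (range e))" "insert t (range e) \<subseteq> carrier G"
    using e t by auto
  obtain S where S: "countable S" "insert t (range e) \<subseteq> S" "S \<subseteq> carrier G"
    and Sm: "\<And>x y. x \<in> S \<Longrightarrow> y \<in> S \<Longrightarrow> x \<otimes> y \<in> S" and Si: "\<And>x. x \<in> S \<Longrightarrow> inv x \<in> S"
    and ST: "\<And>x y z w. \<lbrakk>x \<in> S; y \<in> S; z \<in> S; w \<in> S\<rbrakk> \<Longrightarrow> T x y z w \<in> S"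
    and SD: "\<And>x y n. x \<in> S \<Longrightarrow> y \<in> S \<Longrightarrow> D x y n \<in> S"
  proof (rule countable_closure[OF B, of "(\<otimes>)" "m_inv G" T D])
    fix a b c d assume "a \<in> carrier G" "b \<in> carrier G" "c \<in> carrier G" "d \<in> carrier G"
    then show "T a b c d \<in> carrier G" using T by simp
  next
    fix a b n assume "a \<in> carrier G" "b \<in> carrier G"
    then have "range (D a b) \<subseteq> carrier G" using D by simp
    then show "D a b n \<in> carrier G" by auto
  qed simp_all
  have infS: "infinite S"
    using S(2) e(1) by (meson finite_subset insert_subset range_inj_infinite)
  have subS: "subgroup S G"
    using S Sm Si by (intro subgroupI) auto
  interpret GS: group "G\<lparr>carrier := S\<rparr>" by (rule subgroup_imp_group[OF subS])
  have invS: "inv\<^bsub>G\<lparr>carrier := S\<rparr>\<^esub> x = inv x" if "x \<in> S" for x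
    using m_inv_consistent[OF subS that] .
  have sim: "is_simple_group (G\<lparr>carrier := S\<rparr>)"
    unfolding is_simple_group_def
  proof (intro conjI allI impI)
    show "group (G\<lparr>carrier := S\<rparr>)" by (rule GS.is_group)
    show "carrier (G\<lparr>carrier := S\<rparr>) \<noteq> {\<one>\<^bsub>G\<lparr>carrier := S\<rparr>\<^esub>}"
      using infS by auto
    fix N assume N: "N \<lhd> G\<lparr>carrier := S\<rparr>"
    have subN: "subgroup N (G\<lparr>carrier := S\<rparr>)" using N by (rule normal_imp_subgroup)
    then have NS: "N \<subseteq> S" using subgroup.subset by force
    have N1: "\<one> \<in> N" using subgroup.one_closed[OF subN] by simp
    have NG: "subgroup N G" using incl_subgroup[OF subS subN] .
    have conj: "g \<otimes> a \<otimes> inv g \<in> N" if "g \<in> S" "a \<in> N" for g a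
      using GS.normal_invE(2)[OF N, of g a] that invS by simp
    show "N = carrier (G\<lparr>carrier := S\<rparr>) \<or> N = {\<one>\<^bsub>G\<lparr>carrier := S\<rparr>\<^esub>}"
    proof (cases "N = {\<one>}")
      case False
      then obtain a where a: "a \<in> N" "a \<noteq> \<one>" using N1 by blast
      have "b \<in> N" if b: "b \<in> S" for b
      proof -
        have aS: "a \<in> S" using a(1) NS by (rule rev_subsetD)
        have aG: "a \<in> carrier G" using aS S(3) by (rule rev_subsetD)
        have bG: "b \<in> carrier G" using b S(3) by (rule rev_subsetD)
        have "b \<in> generate G ((\<lambda>g. g \<otimes> a \<otimes> inv g) ` range (D a b))"
          using D[OF aG bG] a(2) by simp
        moreover have "(\<lambda>g. g \<otimes> a \<otimes> inv g) ` range (D a b) \<subseteq> N"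
          using conj[OF SD[OF aS b] a(1)] by auto
        ultimately show ?thesis using generate_subgroup_incl[OF _ NG] by blast
      qed
      then show ?thesis using NS by auto
    qed simp
  qed
  define Z where "Z = (\<lambda>g. \<phi> g p) ` S"
  define \<psi> where "\<psi> = (\<lambda>g. restrict (\<phi> g) Z)"
  have ZY: "Z \<subseteq> Y" using act pq S(3) by (auto simp: Z_def)
  have SG: "g \<in> carrier G" if "g \<in> S" for g using that S(3) by blast
  have actZ: "\<phi> g z \<in> Z" if gz: "g \<in> S" "z \<in> Z" for g z
  proof -
    obtain k where k: "k \<in> S" "z = \<phi> k p" using gz(2) by (auto simp: Z_def)
    have "\<phi> g z = \<phi> (g \<otimes> k) p"
      using composition_rule[of p g k] pq(1) k SG[OF gz(1)] SG[OF k(1)] by simp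
    then show ?thesis using Sm[OF gz(1) k(1)] by (auto simp: Z_def)
  qed
  have \<psi>_Bij: "\<psi> g \<in> Bij Z" if g: "g \<in> S" for g
  proof -
    have "inj_on (\<phi> g) Z" using inj_prop[OF SG[OF g]] ZY by (rule inj_on_subset)
    moreover have "z \<in> \<phi> g ` Z" if "z \<in> Z" for z
    proof -
      have "\<phi> g (\<phi> (inv g) z) = z"
      proof -
        have zY: "z \<in> Y" using that ZY by blast
        then have "\<phi> \<one> z = z" using fun_cong[OF id_eq_one, of z] by simp
        then show ?thesis
          using composition_rule[OF zY SG[OF g] inv_closed[OF SG[OF g]]] r_inv[OF SG[OF g]] by simp
      qed
      moreover have "\<phi> (inv g) z \<in> Z" using actZ Si g that by blast
      ultimately show ?thesis by (metis imageI)
    qed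
    ultimately have "bij_betw (\<phi> g) Z Z" using actZ g by (auto simp: bij_betw_def)
    then show ?thesis by (simp add: Bij_def \<psi>_def)
  qed
  have \<psi>_mult: "\<psi> (a \<otimes> b) = compose Z (\<psi> a) (\<psi> b)" if "a \<in> S" "b \<in> S" for a b
  proof
    fix z
    show "\<psi> (a \<otimes> b) z = compose Z (\<psi> a) (\<psi> b) z"
      using that composition_rule[of z a b] SG[of a] SG[of b] subsetD[OF ZY, of z] actZ[of b z]
      by (simp add: \<psi>_def compose_def)
  qed
  have "group_action (G\<lparr>carrier := S\<rparr>) Z \<psi>"
    unfolding group_action_def group_hom_def group_hom_axioms_def hom_def
    using GS.is_group group_BijGroup[of Z] \<psi>_Bij \<psi>_mult by (auto simp: BijGroup_def)
  moreover have "\<exists>x\<in>Z. \<exists>y\<in>Z. x \<noteq> y"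
  proof -
    have "\<one> \<in> S" using subS by (rule subgroup.one_closed)
    moreover have "\<phi> \<one> p = p" using fun_cong[OF id_eq_one, of p] pq by simp
    ultimately have "p \<in> Z" unfolding Z_def by (metis imageI)
    moreover have "q \<in> Z" using t S(2) by (auto simp: Z_def)
    ultimately show ?thesis using pq by blast
  qed
  moreover have "\<exists>!g. g \<in> carrier (G\<lparr>carrier := S\<rparr>) \<and> \<psi> g x1 = y1 \<and> \<psi> g x2 = y2"
    if Z: "x1 \<in> Z" "x2 \<in> Z" "y1 \<in> Z" "y2 \<in> Z" and ne: "x1 \<noteq> x2" "y1 \<noteq> y2" for x1 x2 y1 y2
  proof -
    obtain a b c d where S4: "a \<in> S" "b \<in> S" "c \<in> S" "d \<in> S"
      and eqs: "x1 = \<phi> a p" "x2 = \<phi> b p" "y1 = \<phi> c p" "y2 = \<phi> d p"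
      using Z by (auto simp: Z_def)
    have 1: "T a b c d \<in> S" "\<phi> (T a b c d) x1 = y1" "\<phi> (T a b c d) x2 = y2"
      using T[of a b c d] ST S4 SG ne eqs by simp_all
    have 2: "\<exists>!g. g \<in> carrier G \<and> \<phi> g x1 = y1 \<and> \<phi> g x2 = y2"
      using sharply_2_transitive[of x1 x2 y1 y2] Z ZY ne by blast
    show ?thesis
    proof (rule ex1I[of _ "T a b c d"])
      show "T a b c d \<in> carrier (G\<lparr>carrier := S\<rparr>) \<and> \<psi> (T a b c d) x1 = y1 \<and> \<psi> (T a b c d) x2 = y2"
        using 1 Z by (simp add: \<psi>_def)
    next
      fix g assume "g \<in> carrier (G\<lparr>carrier := S\<rparr>) \<and> \<psi> g x1 = y1 \<and> \<psi> g x2 = y2"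
      then have "g \<in> S" "\<phi> g x1 = y1" "\<phi> g x2 = y2" using Z by (auto simp: \<psi>_def)
      then show "g = T a b c d" using 1 2 SG by blast
    qed
  qed
  ultimately have "sharply_2_transitive_action (G\<lparr>carrier := S\<rparr>) Z \<psi>"
    by (simp add: sharply_2_transitive_action_def sharply_2_transitive_action_axioms_def)
  then show thesis using that[OF S(1) infS subS sim _ ZY] by simp
qed

theorem nat_carrier_suffices:
  fixes G :: "('a, 'm) monoid_scheme"
  assumes "infinite (carrier G)" "is_simple_group G" "sharply_2_transitive_group G"
  shows "\<exists>H :: nat monoid.
    infinite (carrier H) \<and> is_simple_group H \<and> sharply_2_transitive_group H"
proof -
  from assms(3) obtain Y :: "'a set" and \<phi> where "sharply_2_transitive_action G Y \<phi>"
    by (auto simp: sharply_2_transitive_group_def)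
  from countable_sharply_2_transitive_simple_subgroup[OF assms(1,2) this]
  obtain S and Z :: "'a set" and \<psi> where S: "countable S" "infinite S" "subgroup S G"
    and sim: "is_simple_group (G\<lparr>carrier := S\<rparr>)"
    and s2t: "sharply_2_transitive_action (G\<lparr>carrier := S\<rparr>) Z \<psi>" by metis
  interpret K: group "G\<lparr>carrier := S\<rparr>" using sim by (simp add: is_simple_group_def)
  obtain f :: "'a \<Rightarrow> nat" where f: "inj_on f S" using S(1) by (auto simp: countable_def)
  define h where "h = the_inv_into S f"
  have hf: "h (f x) = x" if "x \<in> S" for x using f that by (simp add: h_def the_inv_into_f_f)
  define H :: "nat monoid" where
    "H = \<lparr>carrier = f ` S, monoid.mult = \<lambda>x y. f (h x \<otimes>\<^bsub>G\<^esub> h y), one = f \<one>\<^bsub>G\<^esub>\<rparr>"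
  have cl: "x \<otimes>\<^bsub>G\<^esub> y \<in> S" if "x \<in> S" "y \<in> S" for x y using K.m_closed[of x y] that by simp
  have one: "\<one>\<^bsub>G\<^esub> \<in> S" using K.one_closed by simp
  have "group H"
  proof (rule groupI)
    fix x assume "x \<in> carrier H"
    then obtain a where a: "a \<in> S" "x = f a" by (auto simp: H_def)
    have "inv\<^bsub>G\<lparr>carrier := S\<rparr>\<^esub> a \<in> S" "inv\<^bsub>G\<lparr>carrier := S\<rparr>\<^esub> a \<otimes>\<^bsub>G\<^esub> a = \<one>\<^bsub>G\<^esub>"
      using K.inv_closed[of a] K.l_inv[of a] a by simp_all
    then show "\<exists>y\<in>carrier H. y \<otimes>\<^bsub>H\<^esub> x = \<one>\<^bsub>H\<^esub>" using a hf
      by (intro bexI[of _ "f (inv\<^bsub>G\<lparr>carrier := S\<rparr>\<^esub> a)"]) (simp_all add: H_def)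
    show "\<one>\<^bsub>H\<^esub> \<otimes>\<^bsub>H\<^esub> x = x" using a hf one K.l_one[of a] by (simp add: H_def)
  next
    fix x y z assume "x \<in> carrier H" "y \<in> carrier H" "z \<in> carrier H"
    then show "x \<otimes>\<^bsub>H\<^esub> y \<otimes>\<^bsub>H\<^esub> z = x \<otimes>\<^bsub>H\<^esub> (y \<otimes>\<^bsub>H\<^esub> z)"
      using hf cl K.m_assoc by (auto simp: H_def)
  qed (use cl one hf in \<open>auto simp: H_def\<close>)
  moreover have iso: "h \<in> iso H (G\<lparr>carrier := S\<rparr>)"
    using f hf cl bij_betw_the_inv_into[of f S "f ` S"]
    by (auto simp: iso_def hom_def H_def h_def bij_betw_def)
  moreover have "infinite (carrier H)" using S f by (simp add: H_def finite_image_iff)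
  ultimately show ?thesis
    using is_simple_group_iso[OF sim] sharply_2_transitive_action_iso[OF s2t]
      sharply_2_transitive_groupI by blast
qed

end

theory Submission
  imports Defs "HOL-Combinatorics.Permutations"
begin

text \<open>
  A group acts sharply 2-transitively if a non-trivial element fixes at most one point and every
  ordered pair of distinct points can be moved to every other one. The first property is
  kept as an invariant of permutation groups \<open>\<Gamma>\<close> on a countable set \<open>X\<close>, together with the condition that
  involutions have no fixed points. The second property and simplicity are produced by enlarging
  \<open>\<Gamma>\<close> and \<open>X\<close> again and again. Fix an involution \<open>t\<close> that swaps two base points \<open>x0\<close>, \<open>y0\<close>.

  \<^item> If no element of \<open>\<Gamma>\<close> moves \<open>(x0, y0)\<close> to \<open>(a, b)\<close>, adjoin a permutation \<open>\<zeta>\<close> that does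
    (\<open>adjoin_transporter\<close>). If some \<open>s\<close> in \<open>\<Gamma>\<close> swaps \<open>a\<close> and \<open>b\<close>, sharpness forces
    \<open>\<zeta> t = s \<zeta>\<close>; otherwise \<open>\<zeta>\<close> is subject to no relation.
  \<^item> If \<open>g \<noteq> 1\<close> and \<open>h \<noteq> g\<close>, adjoin a permutation \<open>z\<close> subject to no relation and put
    \<open>p = z\<^sup>-\<^sup>1 g z g\<^sup>-\<^sup>1\<close>. No power of \<open>p\<close> or of \<open>p h\<close> with positive exponent has a fixed point, so
    one can adjoin \<open>v\<close> with \<open>v p v\<^sup>-\<^sup>1 = p h\<close>. Then \<open>h = p\<^sup>-\<^sup>1 v p v\<^sup>-\<^sup>1\<close> lies in the normal closure of \<open>g\<close>
    (\<open>adjoin_derivation\<close>).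

  A countable chain in which every instance of these two demands is met has a union with all
  the required properties (\<open>limit_sharp\<close>, \<open>saturated_group\<close>); a normal subgroup that contains some
  \<open>g \<noteq> 1\<close> contains every \<open>h\<close>.

  Both enlargements are HNN extensions and come from one construction (\<open>completion\<close>). The new
  letter \<open>\<zeta>\<close> conjugates a subgroup \<open>H\<close> to a subgroup \<open>K\<close>, both acting freely on \<open>X\<close>, and it may be
  prescribed on an \<open>H\<close>-invariant subset of \<open>X\<close>. Elsewhere it is defined in the
  freest possible way: whenever a value of \<open>\<zeta>\<close> or \<open>\<zeta>\<^sup>-\<^sup>1\<close> is missing, a new regular orbit of \<open>\<Gamma>\<close> is
  attached. Apart from the prescribed values, the orbits then hang together like a tree. A word that
  fixes two points, or whose square is trivial, moves pairs of points along closed paths; where such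
  a path is highest, it has to turn back along the edge by which it came, so the word can be
  shortened up to conjugation. The conditions on the prescribed values make this true inside \<open>X\<close> as well. What
  remains in the end is a conjugate of an element of \<open>\<Gamma>\<close>, for which the invariant is known.
\<close>

section \<open>Permutation groups whose non-trivial elements fix at most one point\<close>

abbreviation pinv :: "('a \<Rightarrow> 'a) \<Rightarrow> 'a \<Rightarrow> 'a" where
  "pinv g \<equiv> inv_into UNIV g"

locale sharp_perm_group =
  fixes X :: "'a set" and \<Gamma> :: "('a \<Rightarrow> 'a) set"
  assumes permutes: "g \<in> \<Gamma> \<Longrightarrow> g permutes X"
    and id_mem: "id \<in> \<Gamma>"
    and comp_mem: "g \<in> \<Gamma> \<Longrightarrow> h \<in> \<Gamma> \<Longrightarrow> g \<circ> h \<in> \<Gamma>"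
    and pinv_mem: "g \<in> \<Gamma> \<Longrightarrow> pinv g \<in> \<Gamma>"
    and sharp: "\<lbrakk>g \<in> \<Gamma>; x \<in> X; y \<in> X; x \<noteq> y; g x = x; g y = y\<rbrakk> \<Longrightarrow> g = id"
    and involution_free: "\<lbrakk>g \<in> \<Gamma>; g \<circ> g = id; x \<in> X; g x = x\<rbrakk> \<Longrightarrow> g = id"
begin

lemma maps_to: "g \<in> \<Gamma> \<Longrightarrow> x \<in> X \<Longrightarrow> g x \<in> X"
  using permutes permutes_in_image by metis

lemma pinv_left: "g \<in> \<Gamma> \<Longrightarrow> pinv g \<circ> g = id"
  using permutes permutes_inv_o(2) by blast

lemma pinv_right: "g \<in> \<Gamma> \<Longrightarrow> g \<circ> pinv g = id"
  using permutes permutes_inv_o(1) by blast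

lemma pinv_left_apply: "g \<in> \<Gamma> \<Longrightarrow> pinv g (g x) = x"
  using permutes permutes_inverses(2) by metis

lemma pinv_right_apply: "g \<in> \<Gamma> \<Longrightarrow> g (pinv g x) = x"
  using permutes permutes_inverses(1) by metis

lemma inj_mem: "g \<in> \<Gamma> \<Longrightarrow> g x = g y \<longleftrightarrow> x = y"
  by (metis pinv_left_apply)

lemma eq_if_pinv_comp_id: "g \<in> \<Gamma> \<Longrightarrow> pinv g \<circ> h = id \<Longrightarrow> h = g"
  by (metis comp_assoc comp_id id_comp pinv_right)

lemma right_cancel: "g \<in> \<Gamma> \<Longrightarrow> h \<circ> g = g \<Longrightarrow> h = id"
  by (metis comp_assoc comp_id pinv_right)

lemma eq_if_agree:
  assumes "g \<in> \<Gamma>" "h \<in> \<Gamma>" "x \<in> X" "y \<in> X" "x \<noteq> y" "g x = h x" "g y = h y"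
  shows "g = h"
proof -
  have "pinv h \<circ> g = id"
    by (rule sharp[of _ x y]) (use assms in \<open>auto simp: comp_mem pinv_mem pinv_left_apply\<close>)
  then show ?thesis using eq_if_pinv_comp_id assms by blast
qed

end

text \<open>
  The embedding of the smaller group into the larger one is not part of the data: when \<open>X\<close> has two
  points and the larger group is sharp, the element \<open>g'\<close> is determined by \<open>g\<close>.
\<close>

definition extends ::
  "'a set \<Rightarrow> ('a \<Rightarrow> 'a) set \<Rightarrow> 'a set \<Rightarrow> ('a \<Rightarrow> 'a) set \<Rightarrow> bool" where
  "extends X \<Gamma> X' \<Gamma>' \<longleftrightarrow> X \<subseteq> X' \<and> (\<forall>g\<in>\<Gamma>. \<exists>g'\<in>\<Gamma>'. \<forall>x\<in>X. g' x = g x)"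

definition lifts ::
  "'a set \<Rightarrow> ('a \<Rightarrow> 'a) set \<Rightarrow> ('a \<Rightarrow> 'a) set \<Rightarrow> (('a \<Rightarrow> 'a) \<Rightarrow> 'a \<Rightarrow> 'a) \<Rightarrow> bool" where
  "lifts X \<Gamma> \<Gamma>' L \<longleftrightarrow> (\<forall>g\<in>\<Gamma>. L g \<in> \<Gamma>' \<and> (\<forall>x\<in>X. L g x = g x))"

lemma lifts_mem: "lifts X \<Gamma> \<Gamma>' L \<Longrightarrow> g \<in> \<Gamma> \<Longrightarrow> L g \<in> \<Gamma>'"
  by (simp add: lifts_def)

lemma lifts_eq: "lifts X \<Gamma> \<Gamma>' L \<Longrightarrow> g \<in> \<Gamma> \<Longrightarrow> x \<in> X \<Longrightarrow> L g x = g x"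
  by (simp add: lifts_def)

lemma extends_iff_lifts: "extends X \<Gamma> X' \<Gamma>' \<longleftrightarrow> X \<subseteq> X' \<and> (\<exists>L. lifts X \<Gamma> \<Gamma>' L)"
  unfolding extends_def lifts_def by metis

lemma extends_refl: "extends X \<Gamma> X \<Gamma>"
  by (auto simp: extends_def)

lemma extends_trans:
  assumes "extends X \<Gamma> X' \<Gamma>'" "extends X' \<Gamma>' X'' \<Gamma>''"
  shows "extends X \<Gamma> X'' \<Gamma>''"
  using assms unfolding extends_def by (metis subset_iff)

section \<open>Completing a partial stable letter\<close>

text \<open>
  The points of the completion are reduced words. \<open>New e k p\<close> stands for the image of \<open>p\<close> under
  the letter \<open>\<zeta>\<close> (\<open>e = True\<close>) or \<open>\<zeta>\<^sup>-\<^sup>1\<close> (\<open>e = False\<close>) followed by the group element \<open>k\<close>. The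
  level of a point is its distance from \<open>X\<close> in the tree of orbits.
\<close>

datatype 'a pt = Old 'a | New bool "'a \<Rightarrow> 'a" "'a pt"

primrec act :: "('a \<Rightarrow> 'a) \<Rightarrow> 'a pt \<Rightarrow> 'a pt" where
  "act g (Old x) = Old (g x)"
| "act g (New e k p) = New e (g \<circ> k) p"

primrec level :: "'a pt \<Rightarrow> nat" where
  "level (Old x) = 0"
| "level (New e k p) = Suc (level p)"

lemma act_act: "act g (act h p) = act (g \<circ> h) p"
  by (cases p) (auto simp: comp_assoc)

lemma act_id [simp]: "act id p = p"
  by (cases p) auto

lemma level_act [simp]: "level (act g p) = level p"
  by (cases p) auto

text \<open>
  The data of an HNN extension with a partial action, indexed by the sign of the letter so that \<open>\<zeta>\<close>
  and \<open>\<zeta>\<^sup>-\<^sup>1\<close> are treated alike: \<open>\<zeta>\<close> conjugates \<open>H True\<close> to \<open>H False\<close> via \<open>\<phi> True\<close> and maps \<open>Y True\<close>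
  to \<open>Y False\<close> via \<open>\<theta> True\<close>. Pairs of prescribed points are the only place where closed paths could arise
  that are not forced by the relations. The last two assumptions exclude them: from a pair in
  \<open>Y False\<close> the only way on inside \<open>X\<close> is by \<open>\<zeta>\<^sup>-\<^sup>1\<close>, and it is unique up to \<open>H False\<close>.
\<close>

locale partial_stable_letter = sharp_perm_group X \<Gamma> for X :: "'a set" and \<Gamma> +
  fixes H :: "bool \<Rightarrow> ('a \<Rightarrow> 'a) set" and \<phi> :: "bool \<Rightarrow> ('a \<Rightarrow> 'a) \<Rightarrow> ('a \<Rightarrow> 'a)"
    and Y :: "bool \<Rightarrow> 'a set" and \<theta> :: "bool \<Rightarrow> 'a \<Rightarrow> 'a"
  assumes H_sub: "h \<in> H e \<Longrightarrow> h \<in> \<Gamma>"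
    and H_id: "id \<in> H e"
    and H_comp: "h \<in> H e \<Longrightarrow> k \<in> H e \<Longrightarrow> h \<circ> k \<in> H e"
    and H_pinv: "h \<in> H e \<Longrightarrow> pinv h \<in> H e"
    and H_free: "\<lbrakk>h \<in> H e; x \<in> X; h x = x\<rbrakk> \<Longrightarrow> h = id"
    and \<phi>_in: "h \<in> H e \<Longrightarrow> \<phi> e h \<in> H (\<not> e)"
    and \<phi>_back: "h \<in> H e \<Longrightarrow> \<phi> (\<not> e) (\<phi> e h) = h"
    and \<phi>_comp: "h \<in> H e \<Longrightarrow> k \<in> H e \<Longrightarrow> \<phi> e (h \<circ> k) = \<phi> e h \<circ> \<phi> e k"
    and Y_sub: "y \<in> Y e \<Longrightarrow> y \<in> X"
    and Y_inv: "h \<in> H e \<Longrightarrow> y \<in> Y e \<Longrightarrow> h y \<in> Y e"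
    and \<theta>_in: "y \<in> Y e \<Longrightarrow> \<theta> e y \<in> Y (\<not> e)"
    and \<theta>_back: "y \<in> Y e \<Longrightarrow> \<theta> (\<not> e) (\<theta> e y) = y"
    and \<theta>_equiv: "h \<in> H e \<Longrightarrow> y \<in> Y e \<Longrightarrow> \<theta> e (h y) = \<phi> e h (\<theta> e y)"
    and no_transfer:
      "\<lbrakk>g \<in> \<Gamma>; y \<in> Y True; y' \<in> Y True; y \<noteq> y'; g y \<in> Y False; g y' \<in> Y False\<rbrakk> \<Longrightarrow> False"
    and pair_stabilizer:
      "\<lbrakk>g \<in> \<Gamma>; y \<in> Y False; y' \<in> Y False; y \<noteq> y'; g y \<in> Y False; g y' \<in> Y False\<rbrakk>
        \<Longrightarrow> g \<in> H False"
begin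

text \<open>
  Every orbit of \<open>H e\<close> gets a representative \<open>rep e p\<close>, and \<open>offset e p\<close> is the element of \<open>H e\<close> that
  leads from the representative to \<open>p\<close>.
\<close>

definition orb :: "bool \<Rightarrow> 'a pt \<Rightarrow> 'a pt set" where
  "orb e p = (\<lambda>h. act h p) ` H e"

definition rep :: "bool \<Rightarrow> 'a pt \<Rightarrow> 'a pt" where
  "rep e p = (SOME q. q \<in> orb e p)"

definition offset :: "bool \<Rightarrow> 'a pt \<Rightarrow> 'a \<Rightarrow> 'a" where
  "offset e p = (SOME h. h \<in> H e \<and> p = act h (rep e p))"

text \<open>
  The points at which the letter of sign \<open>e\<close> needs no new point, either because its value is
  prescribed or because it undoes the last letter.
\<close>

definition nonfresh :: "bool \<Rightarrow> 'a pt \<Rightarrow> bool" where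
  "nonfresh e p \<longleftrightarrow> (\<exists>y\<in>Y e. p = Old y) \<or> (\<exists>k\<in>H e. \<exists>q. p = New (\<not> e) k q)"

text \<open>
  Only the representative of an \<open>H e\<close>-orbit receives a new image: equivariance determines the
  images of the other points of that orbit.
\<close>

inductive_set V :: "'a pt set" where
  Old: "x \<in> X \<Longrightarrow> Old x \<in> V"
| New: "\<lbrakk>p \<in> V; g \<in> \<Gamma>; rep e p = p; \<not> nonfresh e p\<rbrakk> \<Longrightarrow> New e g p \<in> V"

definition letter :: "bool \<Rightarrow> 'a pt \<Rightarrow> 'a pt" where
  "letter e p = (if nonfresh e p then (case p of Old y \<Rightarrow> Old (\<theta> e y) | New _ k q \<Rightarrow> act (\<phi> e k) q)
             else New e (\<phi> e (offset e p)) (rep e p))"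

lemma act_pinv: "g \<in> \<Gamma> \<Longrightarrow> act (pinv g) (act g p) = p"
  by (simp add: act_act pinv_left)

lemma act_pinv': "g \<in> \<Gamma> \<Longrightarrow> act g (act (pinv g) p) = p"
  by (simp add: act_act pinv_right)

lemma act_V: "p \<in> V \<Longrightarrow> g \<in> \<Gamma> \<Longrightarrow> act g p \<in> V"
  by (erule V.cases) (simp_all add: V.intros maps_to comp_mem)

lemma New_in_V: "New e g p \<in> V \<Longrightarrow> p \<in> V \<and> g \<in> \<Gamma> \<and> rep e p = p \<and> \<not> nonfresh e p"
  by (erule V.cases) simp_all

lemma Old_in_V: "Old x \<in> V \<longleftrightarrow> x \<in> X"
  by (auto intro: V.intros elim: V.cases)

lemma act_New_fixed: "New e k q \<in> V \<Longrightarrow> act g (New e k q) = New e k q \<Longrightarrow> g = id"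
  using New_in_V[of e k q] right_cancel[of k g] by simp

text \<open>
  Freeness is inherited by the completion because all new \<open>\<Gamma>\<close>-orbits are regular.
\<close>

lemma act_free: "p \<in> V \<Longrightarrow> h \<in> H e \<Longrightarrow> act h p = p \<Longrightarrow> h = id"
proof (cases p)
  case (Old x)
  then show "p \<in> V \<Longrightarrow> h \<in> H e \<Longrightarrow> act h p = p \<Longrightarrow> h = id" using H_free[of h e x] by (simp add: Old_in_V)
qed (use act_New_fixed in blast)

lemma act_sharp:
  assumes "g \<in> \<Gamma>" "p \<in> V" "q \<in> V" "p \<noteq> q" "act g p = p" "act g q = q"
  shows "g = id"
proof (cases "(\<exists>x. p = Old x) \<and> (\<exists>y. q = Old y)")
  case True
  then obtain x y where "p = Old x" "q = Old y" by blast
  then show ?thesis using assms sharp[of g x y] by (simp add: Old_in_V)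
next
  case False
  then show ?thesis using assms act_New_fixed by (metis pt.exhaust)
qed

lemma act_involution:
  assumes "g \<in> \<Gamma>" "g \<circ> g = id" "p \<in> V" "act g p = p"
  shows "g = id"
proof (cases p)
  case (Old x)
  then show ?thesis using assms involution_free[of g x] by (simp add: Old_in_V)
qed (use assms act_New_fixed in blast)

lemma orb_act:
  assumes h: "h \<in> H e" shows "orb e (act h p) = orb e p"
proof -
  have "act k p \<in> orb e (act h p)" if "k \<in> H e" for k
  proof -
    have "act k p = act (k \<circ> pinv h) (act h p)"
      using pinv_left[OF H_sub[OF h]] by (simp add: act_act comp_assoc)
    then show ?thesis using that h by (auto simp: orb_def H_comp H_pinv)
  qed
  then show ?thesis using h by (auto simp: orb_def act_act H_comp)
qed

lemma rep_act: "h \<in> H e \<Longrightarrow> rep e (act h p) = rep e p"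
  by (simp add: rep_def orb_act)

lemma rep_in_orb: "rep e p \<in> orb e p"
proof -
  have "p \<in> orb e p" unfolding orb_def using H_id[of e] act_id[of p] by (metis image_eqI)
  then show ?thesis unfolding rep_def by (rule someI)
qed

lemma rep_eq_act: obtains h where "h \<in> H e" "rep e p = act h p"
  using rep_in_orb[of e p] by (auto simp: orb_def)

lemma rep_rep: "rep e (rep e p) = rep e p"
  by (metis rep_act rep_eq_act)

lemma rep_V: "p \<in> V \<Longrightarrow> rep e p \<in> V"
  by (metis rep_eq_act act_V H_sub)

lemma level_rep [simp]: "level (rep e p) = level p"
  by (metis rep_eq_act level_act)

lemma offset: "offset e p \<in> H e" "act (offset e p) (rep e p) = p"
proof -
  obtain h where "h \<in> H e" "rep e p = act h p" by (rule rep_eq_act)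
  then have "pinv h \<in> H e \<and> p = act (pinv h) (rep e p)" by (metis act_pinv H_sub H_pinv)
  then have "offset e p \<in> H e \<and> p = act (offset e p) (rep e p)"
    unfolding offset_def by (rule someI[of "\<lambda>h. h \<in> H e \<and> p = act h (rep e p)"])
  then show "offset e p \<in> H e" "act (offset e p) (rep e p) = p" by auto
qed

lemma offset_eqI:
  assumes p: "p \<in> V" and h: "h \<in> H e" "act h (rep e p) = p"
  shows "offset e p = h"
proof -
  have "act (pinv h \<circ> offset e p) (rep e p) = act (pinv h) (act h (rep e p))"
    using offset[of e p] h by (simp add: act_act[symmetric])
  also have "\<dots> = rep e p" by (rule act_pinv[OF H_sub[OF h(1)]])
  finally have "pinv h \<circ> offset e p = id"
    using act_free[OF rep_V[OF p]] H_comp H_pinv h offset by blast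
  then show ?thesis using eq_if_pinv_comp_id H_sub h by blast
qed

lemma H_cancel:
  assumes h: "h \<in> H e" and hk: "h \<circ> k \<in> H e" shows "k \<in> H e"
proof -
  have "pinv h \<circ> (h \<circ> k) \<in> H e" using H_comp[OF H_pinv[OF h] hk] .
  moreover have "pinv h \<circ> (h \<circ> k) = k"
    using pinv_left_apply[OF H_sub[OF h]] by (simp add: fun_eq_iff)
  ultimately show "k \<in> H e" by simp
qed

lemma H_cancel':
  assumes k: "k \<in> H e" and gk: "g \<circ> k \<in> H e" shows "g \<in> H e"
proof -
  have "(g \<circ> k) \<circ> pinv k \<in> H e" using H_comp[OF gk H_pinv[OF k]] .
  moreover have "(g \<circ> k) \<circ> pinv k = g"
    using pinv_right_apply[OF H_sub[OF k]] by (simp add: fun_eq_iff)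
  ultimately show "g \<in> H e" by simp
qed

lemma nonfresh_act:
  assumes p: "p \<in> V" and h: "h \<in> H e" shows "nonfresh e (act h p) \<longleftrightarrow> nonfresh e p"
proof (cases p)
  case (Old x)
  have "x \<in> Y e" if "h x \<in> Y e"
  proof -
    have "pinv h (h x) \<in> Y e" using Y_inv[OF H_pinv[OF h] that] .
    then show ?thesis using pinv_left_apply[OF H_sub[OF h]] by simp
  qed
  then have "h x \<in> Y e \<longleftrightarrow> x \<in> Y e" using Y_inv[OF h] by blast
  then show ?thesis using Old by (auto simp: nonfresh_def)
next
  case (New e' k q)
  have "h \<circ> k \<in> H e \<longleftrightarrow> k \<in> H e" using H_cancel[OF h] H_comp[OF h] by blast
  then show ?thesis using New by (auto simp: nonfresh_def)
qed

lemma letter_Old: "y \<in> Y e \<Longrightarrow> letter e (Old y) = Old (\<theta> e y)"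
  by (simp add: letter_def nonfresh_def)

lemma letter_back: "k \<in> H e \<Longrightarrow> letter e (New (\<not> e) k q) = act (\<phi> e k) q"
  by (simp add: letter_def nonfresh_def)

lemma letter_back': "k \<in> H (\<not> e) \<Longrightarrow> letter (\<not> e) (New e k q) = act (\<phi> (\<not> e) k) q"
  using letter_back[of k "\<not> e" q] by simp

lemma letter_fresh: "\<not> nonfresh e p \<Longrightarrow> letter e p = New e (\<phi> e (offset e p)) (rep e p)"
  by (simp add: letter_def)

lemma nonfresh_cases:
  assumes "p \<in> V"
  obtains y where "y \<in> Y e" "p = Old y"
  | k q where "k \<in> H e" "p = New (\<not> e) k q" "q \<in> V" "rep (\<not> e) q = q" "\<not> nonfresh (\<not> e) q"
  | "\<not> nonfresh e p"
proof (cases "nonfresh e p")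
  case True
  then consider y where "y \<in> Y e" "p = Old y" | k q where "k \<in> H e" "p = New (\<not> e) k q"
    unfolding nonfresh_def by blast
  then show thesis
  proof cases
    case 2
    then show thesis using that(2)[OF 2] New_in_V assms by simp
  qed (rule that(1))
qed (rule that(3))

lemma nonfresh_rep: "p \<in> V \<Longrightarrow> nonfresh e (rep e p) \<longleftrightarrow> nonfresh e p"
  by (metis rep_eq_act nonfresh_act)

lemma letter_V: assumes p: "p \<in> V" shows "letter e p \<in> V"
  using p
proof (cases rule: nonfresh_cases[of p e])
  case 1
  then show ?thesis using \<theta>_in Y_sub by (auto simp: letter_Old Old_in_V)
next
  case (2 k q)
  then have "\<phi> e k \<in> \<Gamma>" using \<phi>_in H_sub by blast
  then show ?thesis using 2 by (simp add: letter_back act_V)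
next
  case 3
  have "\<phi> e (offset e p) \<in> \<Gamma>" using H_sub[OF \<phi>_in[OF offset(1)]] .
  then show ?thesis using 3 p by (simp add: letter_fresh V.New rep_V rep_rep nonfresh_rep)
qed

lemma letter_letter: assumes p: "p \<in> V" shows "letter (\<not> e) (letter e p) = p"
  using p
proof (cases rule: nonfresh_cases[of p e])
  case 1
  then show ?thesis using \<theta>_in \<theta>_back by (auto simp: letter_Old)
next
  case (2 k q)
  define r where "r = act (\<phi> e k) q"
  have k: "\<phi> e k \<in> H (\<not> e)" using 2 \<phi>_in by auto
  have r: "rep (\<not> e) r = q" "r \<in> V" "\<not> nonfresh (\<not> e) r"
    using 2 k by (auto simp: r_def rep_act nonfresh_act act_V H_sub)
  have "offset (\<not> e) r = \<phi> e k"
    by (rule offset_eqI) (use r k in \<open>auto simp: r_def\<close>)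
  then show ?thesis using 2 r \<phi>_back by (simp add: letter_back letter_fresh flip: r_def)
next
  case 3
  then show ?thesis using offset[of e p] \<phi>_in \<phi>_back by (simp add: letter_fresh letter_back')
qed

lemma letter_letter': assumes p: "p \<in> V" shows "letter e (letter (\<not> e) p) = p"
  using letter_letter[OF p, of "\<not> e"] by simp

lemma letter_act:
  assumes p: "p \<in> V" and h: "h \<in> H e"
  shows "letter e (act h p) = act (\<phi> e h) (letter e p)"
  using p
proof (cases rule: nonfresh_cases[of p e])
  case 1
  then show ?thesis using h Y_inv \<theta>_equiv by (auto simp: letter_Old)
next
  case (2 k q)
  then show ?thesis using h by (simp add: letter_back act_act H_comp \<phi>_comp)
next
  case 3
  have "offset e (act h p) = h \<circ> offset e p"
  proof (rule offset_eqI)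
    show "act h p \<in> V" using p h act_V H_sub by blast
    show "h \<circ> offset e p \<in> H e" using h offset H_comp by blast
    show "act (h \<circ> offset e p) (rep e (act h p)) = act h p"
      using offset[of e p] h by (simp add: rep_act act_act[symmetric])
  qed
  then show ?thesis using 3 p h offset[of e p] by (simp add: letter_fresh nonfresh_act rep_act \<phi>_comp)
qed

lemma level_letter_fresh: "\<not> nonfresh e p \<Longrightarrow> level (letter e p) = Suc (level p)"
  by (simp add: letter_fresh)

end

section \<open>Words and cyclic reduction\<close>

lemma periodic_peak:
  fixes f :: "nat \<Rightarrow> nat"
  assumes N: "N > 0" and per: "\<And>i. f (i + N) = f i"
  shows "\<exists>i. f i \<le> f (Suc i) \<and> f (Suc (Suc i)) \<le> f (Suc i)"
proof -
  obtain j where j: "j < N" "\<And>i. i < N \<Longrightarrow> f i \<le> f j"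
  proof -
    have "Max (f ` {..<N}) \<in> f ` {..<N}" using N by (intro Max_in) auto
    then obtain j where "j < N" "f j = Max (f ` {..<N})" by auto
    then show thesis using that[of j] by simp
  qed
  have mod: "f i = f (i mod N)" for i
  proof -
    have "f (k + m * N) = f k" for k m
    proof (induction m)
      case (Suc m)
      have "f (k + Suc m * N) = f ((k + m * N) + N)" by (simp add: algebra_simps)
      then show ?case using per Suc by simp
    qed simp
    then show ?thesis by (metis mod_mult_div_eq add.commute mult.commute)
  qed
  have "f i \<le> f j" for i using j(2)[of "i mod N"] mod[of i] N by simp
  moreover have "f (Suc (j + N - 1)) = f j" using per N by simp
  ultimately show ?thesis by metis
qed

context partial_stable_letter
begin

definition step :: "bool \<times> ('a \<Rightarrow> 'a) \<Rightarrow> 'a pt \<Rightarrow> 'a pt" where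
  "step l p = letter (fst l) (act (snd l) p)"

primrec run :: "(bool \<times> ('a \<Rightarrow> 'a)) list \<Rightarrow> 'a pt \<Rightarrow> 'a pt" where
  "run [] p = p"
| "run (l # ls) p = run ls (step l p)"

text \<open>
  A word is a list of pairs, applied from the left: first the group element, then the letter of the
  given sign. In a pinch, as in Britton's lemma, a letter and its inverse are separated by an element
  of the associated subgroup only. Indices are taken modulo the length because words matter
  up to conjugation.
\<close>

definition pinches :: "bool \<times> ('a \<Rightarrow> 'a) \<Rightarrow> bool \<times> ('a \<Rightarrow> 'a) \<Rightarrow> bool" where
  "pinches l l' \<longleftrightarrow> fst l' = (\<not> fst l) \<and> snd l' \<in> H (fst l')"

definition reduced :: "(bool \<times> ('a \<Rightarrow> 'a)) list \<Rightarrow> bool" where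
  "reduced ws \<longleftrightarrow> ws \<noteq> [] \<and> snd ` set ws \<subseteq> \<Gamma> \<and>
     (\<forall>i<length ws. \<not> pinches (ws ! i) (ws ! (Suc i mod length ws)))"

lemma run_append: "run (xs @ ys) p = run ys (run xs p)"
  by (induction xs arbitrary: p) auto

lemma step_V: "p \<in> V \<Longrightarrow> snd l \<in> \<Gamma> \<Longrightarrow> step l p \<in> V"
  by (simp add: step_def letter_V act_V)

lemma step_inj:
  assumes "p \<in> V" "q \<in> V" "snd l \<in> \<Gamma>" "step l p = step l q" shows "p = q"
proof -
  have "act (snd l) p = act (snd l) q"
    using assms letter_letter by (metis act_V step_def)
  then show ?thesis using assms act_pinv by metis
qed

lemma level_letter_le: "level (letter e p) \<le> level p \<Longrightarrow> nonfresh e p"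
  using level_letter_fresh[of e p] by force

text \<open>
  From a point outside \<open>X\<close> exactly one edge of the tree does not lead upwards, namely the one
  through which the point was created. A path that arrives from below and does not continue
  upwards therefore backtracks.
\<close>

lemma peak_point:
  assumes p: "p \<in> V" and l: "snd l \<in> \<Gamma>"
    and fresh: "level (step l p) \<noteq> 0"
    and up: "level p \<le> level (step l p)"
    and down: "level (step l' (step l p)) \<le> level (step l p)"
  shows "pinches l l'"
proof -
  define e where "e = fst l"
  define p' where "p' = act (snd l) p"
  have p': "p' \<in> V" "level p' = level p" "step l p = letter e p'"
    using p l by (auto simp: p'_def e_def act_V step_def)
  show ?thesis
    using p'(1)
  proof (cases rule: nonfresh_cases[of p' e])
    case 1
    then show ?thesis using fresh p' by (simp add: letter_Old)
  next
    case 2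
    then show ?thesis using up p' by (simp add: letter_back)
  next
    case 3
    define k where "k = \<phi> e (offset e p')"
    have k: "k \<in> H (\<not> e)" using \<phi>_in offset by (simp add: k_def)
    have new: "step l p = New e k (rep e p')" using 3 p' by (simp add: letter_fresh k_def)
    have "nonfresh (fst l') (act (snd l') (step l p))"
      using level_letter_le[of "fst l'" "act (snd l') (step l p)"] down by (simp add: step_def)
    then have "fst l' = (\<not> e)" "snd l' \<circ> k \<in> H (fst l')" by (auto simp: new nonfresh_def)
    then show ?thesis using H_cancel'[of k "fst l'" "snd l'"] k by (simp add: pinches_def e_def)
  qed
qed

text \<open>
  The level alone does not see the prescribed pairs, which stay at level 0. To make \<open>\<zeta>\<close> lead upwards
  there as well, pairs of old points that can be moved into \<open>Y False\<close> are ranked above the other pairs of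
  old points.
\<close>

definition meets_target :: "'a pt \<Rightarrow> 'a pt \<Rightarrow> bool" where
  "meets_target p q \<longleftrightarrow>
     (\<exists>g\<in>\<Gamma>. \<exists>y\<in>Y False. \<exists>y'\<in>Y False. act g p = Old y \<and> act g q = Old y')"

definition rank :: "'a pt \<Rightarrow> 'a pt \<Rightarrow> nat" where
  "rank p q = (if level p = 0 \<and> level q = 0 then (if meets_target p q then 1 else 0)
               else Suc (max (level p) (level q)))"

lemma level_le_if_rank_le:
  assumes "rank p q \<le> rank p' q'" "level p' \<noteq> 0 \<or> level q' \<noteq> 0"
  shows "max (level p) (level q) \<le> max (level p') (level q')"
  using assms by (auto simp: rank_def split: if_splits)

lemma core_step:
  assumes "level p = 0" "level (step l p) = 0"
  obtains y where "y \<in> Y (fst l)" "act (snd l) p = Old y" "step l p = Old (\<theta> (fst l) y)"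
proof -
  have "nonfresh (fst l) (act (snd l) p)"
    using assms level_letter_le[of "fst l" "act (snd l) p"] by (simp add: step_def)
  moreover have "level (act (snd l) p) = 0" using assms by simp
  then have "act (snd l) p \<noteq> New e k q" for e k q by (metis level.simps(2) nat.distinct(1))
  ultimately obtain y where "y \<in> Y (fst l)" "act (snd l) p = Old y"
    by (auto simp: nonfresh_def)
  then show thesis using that[of y] by (simp add: step_def letter_Old)
qed

text \<open>
  The pair version of the previous observation. If one of the two points is new after the
  first step, the point of maximal level backtracks. If both remain in \<open>X\<close>, the letters act by the prescribed
  values, and \<open>no_transfer\<close> and \<open>pair_stabilizer\<close> leave no way but back.
\<close>

lemma peak_pair:
  assumes pq: "p \<in> V" "q \<in> V" "p \<noteq> q" and l: "snd l \<in> \<Gamma>" "snd l' \<in> \<Gamma>"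
    and up: "rank p q \<le> rank (step l p) (step l q)"
    and down: "rank (step l' (step l p)) (step l' (step l q)) \<le> rank (step l p) (step l q)"
  shows "pinches l l'"
proof (cases "level (step l p) = 0 \<and> level (step l q) = 0")
  case False
  have up': "max (level p) (level q) \<le> max (level (step l p)) (level (step l q))"
    by (rule level_le_if_rank_le[OF up]) (use False in auto)
  have down': "max (level (step l' (step l p))) (level (step l' (step l q)))
      \<le> max (level (step l p)) (level (step l q))"
    by (rule level_le_if_rank_le[OF down]) (use False in auto)
  show ?thesis
  proof (cases "level (step l q) \<le> level (step l p)")
    case True
    show ?thesis
      by (rule peak_point[OF pq(1) l(1)]) (use True False up' down' in auto)
  next
    case F: False
    show ?thesis
      by (rule peak_point[OF pq(2) l(1)]) (use F up' down' in auto)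
  qed
next
  case core: True
  have "rank (step l p) (step l q) \<le> 1" using core by (simp add: rank_def)
  then have core0: "level p = 0" "level q = 0"
    and core2: "level (step l' (step l p)) = 0" "level (step l' (step l q)) = 0"
    using up down by (auto simp: rank_def split: if_splits)
  obtain y where y: "y \<in> Y (fst l)" "act (snd l) p = Old y" "step l p = Old (\<theta> (fst l) y)"
    by (rule core_step[of p l]) (use core core0 in blast)+
  obtain y' where y': "y' \<in> Y (fst l)" "act (snd l) q = Old y'" "step l q = Old (\<theta> (fst l) y')"
    by (rule core_step[of q l]) (use core core0 in blast)+
  have ne: "\<theta> (fst l) y \<noteq> \<theta> (fst l) y'" using step_inj[OF pq(1,2) l(1)] pq y y' by auto
  obtain z where z: "z \<in> Y (fst l')" "act (snd l') (step l p) = Old z"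
    by (rule core_step[of "step l p" l']) (use core core2 in blast)+
  obtain z' where z': "z' \<in> Y (fst l')" "act (snd l') (step l q) = Old z'"
    by (rule core_step[of "step l q" l']) (use core core2 in blast)+
  have images: "snd l' (\<theta> (fst l) y) = z" "snd l' (\<theta> (fst l) y') = z'"
    using z z' y y' by auto
  show ?thesis
  proof (cases "fst l")
    case True
    then have t: "\<theta> True y \<in> Y False" "\<theta> True y' \<in> Y False"
      using \<theta>_in[OF y(1)] \<theta>_in[OF y'(1)] by simp_all
    have "\<not> fst l'"
    proof
      assume l': "fst l'"
      have "z \<noteq> z'"
        using inj_mem[OF l(2), of "\<theta> (fst l) y" "\<theta> (fst l) y'"] ne unfolding images by simp
      moreover have "pinv (snd l') z = \<theta> True y" "pinv (snd l') z' = \<theta> True y'"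
        using True pinv_left_apply[OF l(2)] by (simp_all flip: images)
      ultimately show False
        using no_transfer[OF pinv_mem[OF l(2)], of z z'] z(1) z'(1) l' t by simp
    qed
    moreover have "snd l' \<in> H False"
      by (rule pair_stabilizer[OF l(2) t]) (use calculation ne images z(1) z'(1) True in simp_all)
    ultimately show ?thesis using True by (simp add: pinches_def)
  next
    case False
    then have "meets_target p q"
      using y y' l by (auto simp: meets_target_def)
    then have "rank p q = 1" using core0 by (simp add: rank_def)
    then have "meets_target (step l p) (step l q)"
      using up core by (auto simp: rank_def split: if_splits)
    then obtain g w w' where "g \<in> \<Gamma>" "w \<in> Y False" "w' \<in> Y False"
      "g (\<theta> False y) = w" "g (\<theta> False y') = w'"
      using y y' False by (auto simp: meets_target_def)
    then show ?thesis
      using no_transfer[of g "\<theta> False y" "\<theta> False y'"] \<theta>_in[OF y(1)] \<theta>_in[OF y'(1)]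
        ne False by simp
  qed
qed

primrec traj :: "(bool \<times> ('a \<Rightarrow> 'a)) list \<Rightarrow> 'a pt \<Rightarrow> nat \<Rightarrow> 'a pt" where
  "traj ws p 0 = p"
| "traj ws p (Suc i) = step (ws ! (i mod length ws)) (traj ws p i)"

lemma traj_run:
  assumes "ws \<noteq> []" shows "traj ws p (k * length ws) = (run ws ^^ k) p"
proof (induction k)
  case (Suc k)
  have "traj ws p (k * length ws + j) = run (take j ws) (traj ws p (k * length ws))"
    if "j \<le> length ws" for j
    using that
  proof (induction j)
    case (Suc j)
    then show ?case by (simp add: take_Suc_conv_app_nth run_append)
  qed simp
  from this[of "length ws"] show ?case using Suc by (simp add: add.commute)
qed simp

lemma traj_periodic:
  assumes ws: "ws \<noteq> []" and fp: "(run ws ^^ m) p = p"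
  shows "traj ws p (i + m * length ws) = traj ws p i"
proof (induction i)
  case 0
  then show ?case using traj_run[OF ws, of p m] fp by simp
next
  case (Suc i)
  have "(i + m * length ws) mod length ws = i mod length ws" by simp
  then show ?case using Suc by simp
qed

lemma letter_mem: "reduced ws \<Longrightarrow> snd (ws ! (i mod length ws)) \<in> \<Gamma>"
  unfolding reduced_def by (metis image_subset_iff length_greater_0_conv mod_less_divisor nth_mem)

lemma traj_V: "reduced ws \<Longrightarrow> p \<in> V \<Longrightarrow> traj ws p i \<in> V"
  by (induction i) (auto intro: step_V letter_mem)

lemma reduced_no_pinch:
  "reduced ws \<Longrightarrow> \<not> pinches (ws ! (i mod length ws)) (ws ! (Suc i mod length ws))"
  unfolding reduced_def by (metis length_greater_0_conv mod_Suc_eq mod_less_divisor)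

text \<open>
  The closed path traced by a fixed pair has a highest place. There the word backtracks, so
  it was not cyclically reduced.
\<close>

lemma reduced_power_no_fixed_pair:
  assumes red: "reduced ws" and m: "m > 0" and pq: "p \<in> V" "q \<in> V" "p \<noteq> q"
    and fp: "(run ws ^^ m) p = p" "(run ws ^^ m) q = q"
  shows False
proof -
  have ws: "ws \<noteq> []" using red by (simp add: reduced_def)
  define f where "f i = rank (traj ws p i) (traj ws q i)" for i
  have "m * length ws > 0" using m ws by simp
  moreover have "f (i + m * length ws) = f i" for i
    using traj_periodic[OF ws] fp by (simp add: f_def)
  ultimately obtain i where i: "f i \<le> f (Suc i)" "f (Suc (Suc i)) \<le> f (Suc i)"
    using periodic_peak by blast
  have "traj ws p i \<noteq> traj ws q i" for i
  proof (induction i)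
    case (Suc i)
    then show ?case
      using step_inj[OF traj_V[OF red pq(1)] traj_V[OF red pq(2)] letter_mem[OF red]] by auto
  qed (use pq in simp)
  then have "pinches (ws ! (i mod length ws)) (ws ! (Suc i mod length ws))"
    using i by (intro peak_pair[of "traj ws p i" "traj ws q i"])
      (auto simp: f_def intro: traj_V[OF red] letter_mem[OF red] pq)
  then show False using reduced_no_pinch[OF red] by blast
qed

text \<open>
  Without prescribed values every letter leads from old points to new ones. A closed path then
  leaves level 0, and the argument works for single points already.
\<close>

lemma reduced_power_no_fixed_point:
  assumes red: "reduced ws" and m: "m > 0" and p: "p \<in> V" and Y: "\<And>e. Y e = {}"
  shows "(run ws ^^ m) p \<noteq> p"
proof
  assume fp: "(run ws ^^ m) p = p"
  have ws: "ws \<noteq> []" using red by (simp add: reduced_def)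
  define f where "f i = level (traj ws p i)" for i
  have "m * length ws > 0" using m ws by simp
  moreover have "f (i + m * length ws) = f i" for i
    using traj_periodic[OF ws fp] by (simp add: f_def)
  ultimately obtain i where i: "f i \<le> f (Suc i)" "f (Suc (Suc i)) \<le> f (Suc i)"
    using periodic_peak by blast
  have "f (Suc i) \<noteq> 0"
  proof
    assume "f (Suc i) = 0"
    then show False
      using core_step[of "traj ws p i" "ws ! (i mod length ws)"] Y i(1) by (auto simp: f_def)
  qed
  then have "pinches (ws ! (i mod length ws)) (ws ! (Suc i mod length ws))"
    using i by (intro peak_point[of "traj ws p i"])
      (auto simp: f_def intro: traj_V[OF red] letter_mem[OF red] p)
  then show False using reduced_no_pinch[OF red] by blast
qed

text \<open>
  The members of \<open>W\<close> are maps on the whole datatype, and only their restrictions to \<open>V\<close> are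
  invertible. Identities between them are therefore asserted on \<open>V\<close>.
\<close>

inductive_set W :: "('a pt \<Rightarrow> 'a pt) set" where
  id: "id \<in> W"
| act: "g \<in> \<Gamma> \<Longrightarrow> w \<in> W \<Longrightarrow> act g \<circ> w \<in> W"
| letter: "w \<in> W \<Longrightarrow> letter e \<circ> w \<in> W"

lemma W_V: "w \<in> W \<Longrightarrow> p \<in> V \<Longrightarrow> w p \<in> V"
  by (induction rule: W.induct) (auto simp: act_V letter_V)

lemma W_comp: "w \<in> W \<Longrightarrow> w' \<in> W \<Longrightarrow> w \<circ> w' \<in> W"
  by (induction rule: W.induct) (auto simp: comp_assoc intro: W.intros)

lemma act_W: "g \<in> \<Gamma> \<Longrightarrow> act g \<in> W"
  using W.act[OF _ W.id] by simp

lemma letter_W: "letter e \<in> W"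
  using W.letter[OF W.id] by simp

lemma W_inverse: "w \<in> W \<Longrightarrow> \<exists>w'\<in>W. \<forall>p\<in>V. w' (w p) = p \<and> w (w' p) = p"
proof (induction rule: W.induct)
  case id
  show ?case by (rule bexI[OF _ W.id]) simp
next
  case (act g w)
  then obtain w' where w': "w' \<in> W" "\<forall>p\<in>V. w' (w p) = p \<and> w (w' p) = p" by blast
  have "\<forall>p\<in>V. (w' \<circ> act (pinv g)) ((act g \<circ> w) p) = p \<and> (act g \<circ> w) ((w' \<circ> act (pinv g)) p) = p"
    using act(1) w' by (simp add: act_pinv act_pinv' act_V pinv_mem)
  then show ?case using W_comp[OF w'(1) act_W[OF pinv_mem[OF act(1)]]] by blast
next
  case (letter w e)
  then obtain w' where w': "w' \<in> W" "\<forall>p\<in>V. w' (w p) = p \<and> w (w' p) = p" by blast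
  have "\<forall>p\<in>V. (w' \<circ> letter (\<not> e)) ((letter e \<circ> w) p) = p \<and> (letter e \<circ> w) ((w' \<circ> letter (\<not> e)) p) = p"
    using letter(1) w' by (simp add: letter_letter letter_letter' letter_V W_V)
  then show ?case using W_comp[OF w'(1) letter_W] by blast
qed

lemma run_W: "snd ` set ws \<subseteq> \<Gamma> \<Longrightarrow> run ws \<in> W"
proof (induction ws)
  case Nil
  have "run [] = id" by (simp add: fun_eq_iff)
  then show ?case using W.id by metis
next
  case (Cons l ws)
  have "run (l # ws) = run ws \<circ> (letter (fst l) \<circ> act (snd l))"
    by (simp add: fun_eq_iff step_def)
  moreover have "run ws \<in> W" "snd l \<in> \<Gamma>" using Cons by auto
  ultimately show ?case using W_comp[OF _ W_comp[OF letter_W act_W]] by metis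
qed

definition conjugate :: "('a pt \<Rightarrow> 'a pt) \<Rightarrow> ('a pt \<Rightarrow> 'a pt) \<Rightarrow> bool" where
  "conjugate w c \<longleftrightarrow> (\<exists>u\<in>W. \<forall>p\<in>V. w (u p) = u (c p))"

lemma conjugate_trans:
  assumes "conjugate w c" "conjugate c d" shows "conjugate w d"
proof -
  obtain u v where u: "u \<in> W" "\<forall>p\<in>V. w (u p) = u (c p)"
    and v: "v \<in> W" "\<forall>p\<in>V. c (v p) = v (d p)"
    using assms by (auto simp: conjugate_def)
  have "\<forall>p\<in>V. w ((u \<circ> v) p) = (u \<circ> v) (d p)" using u v W_V by simp
  then show ?thesis unfolding conjugate_def using W_comp u v by blast
qed

lemma conjugate_cong: "(\<And>p. p \<in> V \<Longrightarrow> w p = c p) \<Longrightarrow> conjugate w c"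
  unfolding conjugate_def by (rule bexI[of _ id]) (auto intro: W.id)

lemma conjugate_rotate:
  assumes "snd ` set ws \<subseteq> \<Gamma>" shows "conjugate (run ws) (run (rotate i ws))"
proof -
  define j where "j = i mod length ws"
  have rot: "rotate i ws = drop j ws @ take j ws" by (simp add: j_def rotate_drop_take)
  have "run ws p = run (drop j ws) (run (take j ws) p)" for p
    by (simp add: run_append[symmetric])
  then have "\<forall>p\<in>V. run ws (run (drop j ws) p) = run (drop j ws) (run (rotate i ws) p)"
    by (simp add: rot run_append)
  moreover have "run (drop j ws) \<in> W" 
    by (rule run_W) (use assms in \<open>auto dest: in_set_dropD\<close>)
  ultimately show ?thesis unfolding conjugate_def by blast
qed

lemma run_pinch:
  assumes p: "p \<in> V" and l: "snd l \<in> \<Gamma>" and pinch: "pinches l l'"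
  shows "step l' (step l p) = act (\<phi> (\<not> fst l) (snd l') \<circ> snd l) p"
proof -
  have f: "fst l' = (\<not> fst l)" and "snd l' \<in> H (fst l')"
    using pinch unfolding pinches_def by blast+
  then have m: "snd l' \<in> H (\<not> fst l)" by (simp only:)
  have "step l' (step l p)
      = act (\<phi> (\<not> fst l) (snd l')) (letter (\<not> fst l) (letter (fst l) (act (snd l) p)))"
    unfolding step_def f by (rule letter_act[OF letter_V[OF act_V[OF p l]] m])
  then show ?thesis using p l by (simp add: letter_letter act_V act_act)
qed

text \<open>
  A pinch can be rotated to the front of the word, where the relation \<open>\<zeta> h = \<phi>(h) \<zeta>\<close> removes two
  letters.
\<close>

lemma cyclic_reduction:
  assumes "snd ` set ws \<subseteq> \<Gamma>"
  shows "(\<exists>g\<in>\<Gamma>. conjugate (run ws) (act g)) \<or> (\<exists>us. reduced us \<and> conjugate (run ws) (run us))"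
  using assms
proof (induction "length ws" arbitrary: ws rule: less_induct)
  case less
  show ?case
  proof (cases "ws = [] \<or> reduced ws")
    case True
    then show ?thesis
    proof
      assume "ws = []"
      then have "conjugate (run ws) (act id)" by (intro conjugate_cong) simp
      then show ?thesis using id_mem by blast
    qed (use conjugate_cong in blast)
  next
    case False
    then obtain i where i: "i < length ws" "pinches (ws ! i) (ws ! (Suc i mod length ws))"
      using less.prems by (auto simp: reduced_def)
    then have len: "length ws > 1"
    proof (cases "length ws = 1")
      case True
      then show ?thesis using i by (auto simp: pinches_def)
    qed linarith
    have nth: "rotate i ws ! k = ws ! ((i + k) mod length ws)" if "k < length ws" for k
      using that by (rule nth_rotate)
    obtain l l' r where r: "rotate i ws = l # l' # r"
      using len length_rotate[of i ws]
      by (metis One_nat_def length_Cons list.size(3) neq_Nil_conv not_less_zero less_irrefl)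
    have "l = ws ! i" using nth[of 0] r i by (cases ws) simp_all
    moreover have "l' = ws ! (Suc i mod length ws)" using nth[of 1] r len by simp
    ultimately have pinch: "pinches l l'" using i by simp
    have mem: "snd ` set (rotate i ws) \<subseteq> \<Gamma>" using less.prems by simp
    define k where "k = \<phi> (\<not> fst l) (snd l') \<circ> snd l"
    have k: "k \<in> \<Gamma>"
      using pinch mem r \<phi>_in[of "snd l'" "\<not> fst l"] H_sub
      by (auto simp: k_def pinches_def intro!: comp_mem)
    have run: "run (rotate i ws) p = run r (act k p)" if "p \<in> V" for p
      using run_pinch[OF that _ pinch] mem r by (simp add: k_def)
    have rot: "conjugate (run ws) (run (rotate i ws))" by (rule conjugate_rotate[OF less.prems])
    show ?thesis
    proof (cases r)
      case Nil
      then have "conjugate (run (rotate i ws)) (act k)" using run by (intro conjugate_cong) simp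
      then show ?thesis using k conjugate_trans[OF rot] by blast
    next
      case (Cons l2 r2)
      define vs where "vs = (fst l2, snd l2 \<circ> k) # r2"
      have "length vs < length ws" using Cons r length_rotate[of i ws] by (simp add: vs_def)
      moreover have "snd ` set vs \<subseteq> \<Gamma>" using mem r Cons k by (auto simp: vs_def intro: comp_mem)
      moreover have "conjugate (run (rotate i ws)) (run vs)"
        using run Cons by (intro conjugate_cong) (simp add: vs_def step_def act_act)
      ultimately show ?thesis using less.hyps conjugate_trans rot by metis
    qed
  qed
qed

lemma W_word:
  "w \<in> W \<Longrightarrow> \<exists>g\<in>\<Gamma>. \<exists>ws. snd ` set ws \<subseteq> \<Gamma> \<and> (\<forall>p. w p = act g (run ws p))"
proof (induction rule: W.induct)
  case id
  have "\<forall>p. id p = act id (run [] p)" by (simp only: run.simps act_id id_apply simp_thms)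
  moreover have "snd ` set [] \<subseteq> \<Gamma>" by simp
  ultimately show ?case using id_mem by blast
next
  case (act h w)
  then obtain g ws where "g \<in> \<Gamma>" "snd ` set ws \<subseteq> \<Gamma>" "\<forall>p. w p = act g (run ws p)" by blast
  moreover from this have "\<forall>p. (act h \<circ> w) p = act (h \<circ> g) (run ws p)" by (simp add: act_act)
  ultimately show ?case using act(1) comp_mem by blast
next
  case (letter w e)
  then obtain g ws where "g \<in> \<Gamma>" "snd ` set ws \<subseteq> \<Gamma>" "\<forall>p. w p = act g (run ws p)" by blast
  then have "snd ` set (ws @ [(e, g)]) \<subseteq> \<Gamma>"
    "\<forall>p. (letter e \<circ> w) p = act id (run (ws @ [(e, g)]) p)"
    by (auto simp: run_append step_def)
  then show ?case using id_mem by blast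
qed

lemma W_cyclic_reduction:
  assumes w: "w \<in> W"
  shows "(\<exists>g\<in>\<Gamma>. conjugate w (act g)) \<or> (\<exists>us. reduced us \<and> conjugate w (run us))"
proof -
  obtain g ws where g: "g \<in> \<Gamma>" and ws: "snd ` set ws \<subseteq> \<Gamma>" and eq: "\<And>p. w p = act g (run ws p)"
    using W_word[OF w] by metis
  show ?thesis
  proof (cases ws)
    case Nil
    then have "conjugate w (act g)" using eq by (intro conjugate_cong) simp
    then show ?thesis using g by blast
  next
    case (Cons l r)
    define vs where "vs = (fst l, snd l \<circ> g) # r"
    have "\<forall>p\<in>V. w (act g p) = act g (run vs p)"
      by (simp add: eq Cons vs_def step_def act_act)
    then have "conjugate w (run vs)" unfolding conjugate_def using act_W[OF g] by blast
    moreover have "snd ` set vs \<subseteq> \<Gamma>" using ws Cons g by (auto simp: vs_def intro: comp_mem)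
    ultimately show ?thesis using cyclic_reduction[of vs] conjugate_trans by metis
  qed
qed

lemma conjugate_fixed_point:
  assumes u: "u \<in> W" "\<forall>p\<in>V. w (u p) = u (c p)" and u': "u' \<in> W" "\<forall>p\<in>V. u' (u p) = p \<and> u (u' p) = p"
    and c: "\<And>p. p \<in> V \<Longrightarrow> c p \<in> V" and p: "p \<in> V" "w p = p"
  shows "c (u' p) = u' p"
proof -
  have q: "u' p \<in> V" using W_V[OF u'(1) p(1)] .
  have "u (c (u' p)) = u (u' p)" using u(2) u'(2) p q by metis
  then show ?thesis using u' c q by metis
qed

text \<open>
  A cyclically reduced word has no fixed pair, so an element with two fixed points is conjugate to
  an element of \<open>\<Gamma>\<close>, which then is trivial.
\<close>

lemma W_sharp:
  assumes w: "w \<in> W" and pq: "p \<in> V" "q \<in> V" "p \<noteq> q" "w p = p" "w q = q" and r: "r \<in> V"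
  shows "w r = r"
proof -
  consider g where "g \<in> \<Gamma>" "conjugate w (act g)" | us where "reduced us" "conjugate w (run us)"
    using W_cyclic_reduction[OF w] by blast
  then show ?thesis
  proof cases
    case 1
    then obtain u where u: "u \<in> W" "\<forall>p\<in>V. w (u p) = u (act g p)" by (auto simp: conjugate_def)
    obtain u' where u': "u' \<in> W" "\<forall>p\<in>V. u' (u p) = p \<and> u (u' p) = p" using W_inverse[OF u(1)] by blast
    have "act g (u' p) = u' p" "act g (u' q) = u' q"
      using conjugate_fixed_point[OF u u'] pq 1 act_V by blast+
    moreover have "u' p \<noteq> u' q" using u' pq by metis
    ultimately have "g = id" using act_sharp[of g "u' p" "u' q"] 1 W_V u' pq by blast
    then have "w (u (u' r)) = u (u' r)" using u W_V[OF u'(1) r] by simp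
    then show ?thesis using u' r by simp
  next
    case 2
    then obtain u where u: "u \<in> W" "\<forall>p\<in>V. w (u p) = u (run us p)" by (auto simp: conjugate_def)
    obtain u' where u': "u' \<in> W" "\<forall>p\<in>V. u' (u p) = p \<and> u (u' p) = p" using W_inverse[OF u(1)] by blast
    have "run us (u' p) = u' p" "run us (u' q) = u' q"
      using conjugate_fixed_point[OF u u'] pq 2(1) W_V run_W by (auto simp: reduced_def)
    moreover have "u' p \<noteq> u' q" using u' pq by metis
    ultimately show ?thesis
      using reduced_power_no_fixed_pair[OF 2(1), of 1 "u' p" "u' q"] W_V u' pq by simp
  qed
qed

text \<open>
  An element whose square is trivial cannot be conjugate to a cyclically reduced word, because the square of
  that word would fix every pair. Hence torsion comes from \<open>\<Gamma>\<close>.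
\<close>

lemma W_involution:
  assumes w: "w \<in> W" "\<And>r. r \<in> V \<Longrightarrow> w (w r) = r" and p: "p \<in> V" "w p = p" and r: "r \<in> V"
    and two: "x \<in> X" "y \<in> X" "x \<noteq> y"
  shows "w r = r"
proof -
  consider g where "g \<in> \<Gamma>" "conjugate w (act g)" | us where "reduced us" "conjugate w (run us)"
    using W_cyclic_reduction[OF w(1)] by blast
  then show ?thesis
  proof cases
    case 1
    then obtain u where u: "u \<in> W" "\<forall>p\<in>V. w (u p) = u (act g p)" by (auto simp: conjugate_def)
    obtain u' where u': "u' \<in> W" "\<forall>p\<in>V. u' (u p) = p \<and> u (u' p) = p" using W_inverse[OF u(1)] by blast
    have fixp: "act g (u' p) = u' p" using conjugate_fixed_point[OF u u'] p 1 act_V by blast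
    have sq: "act (g \<circ> g) q = q" if q: "q \<in> V" for q
    proof -
      have "u (act g (act g q)) = w (w (u q))" using u q 1 act_V by metis
      also have "\<dots> = u q" using w(2) W_V u(1) q by blast
      finally show ?thesis using u' q 1 act_V by (metis act_act)
    qed
    have "g \<circ> g = id"
      by (rule act_sharp[of "g \<circ> g" "Old x" "Old y"])
        (use sq[of "Old x"] sq[of "Old y"] two 1 in \<open>auto simp: Old_in_V comp_mem\<close>)
    then have "g = id" using act_involution[OF 1(1)] fixp W_V u' p by blast
    then have "w (u (u' r)) = u (u' r)" using u W_V[OF u'(1) r] by simp
    then show ?thesis using u' r by simp
  next
    case 2
    then obtain u where u: "u \<in> W" "\<forall>p\<in>V. w (u p) = u (run us p)" by (auto simp: conjugate_def)
    obtain u' where u': "u' \<in> W" "\<forall>p\<in>V. u' (u p) = p \<and> u (u' p) = p" using W_inverse[OF u(1)] by blast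
    have run: "run us q \<in> V" if "q \<in> V" for q
      using that 2(1) W_V run_W by (auto simp: reduced_def)
    have sq: "(run us ^^ 2) q = q" if q: "q \<in> V" for q
    proof -
      have "u (run us (run us q)) = w (w (u q))" using u q run by metis
      also have "\<dots> = u q" using w(2) W_V u(1) q by blast
      finally show ?thesis using u' q run by (metis comp_apply funpow_0 funpow_Suc_right numeral_2_eq_2)
    qed
    then show ?thesis
      using reduced_power_no_fixed_pair[OF 2(1), of 2 "Old x" "Old y"] two by (simp add: Old_in_V)
  qed
qed

text \<open>
  Two generic words of this shape are made conjugate later on to obtain simplicity. The signs alternate
  but \<open>a\<close> and \<open>b\<close> are outside the trivial group \<open>H e\<close>, so nothing pinches.
\<close>

lemma alternating_word_no_fixed_point:
  assumes a: "a \<in> \<Gamma>" "a \<noteq> id" and b: "b \<in> \<Gamma>" "b \<noteq> id" and H: "\<And>e. H e = {id}"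
    and Y: "\<And>e. Y e = {}" and m: "m > 0" and p: "p \<in> V"
  shows "((letter False \<circ> act a \<circ> letter True \<circ> act b) ^^ m) p \<noteq> p"
proof -
  define ws where "ws = [(True, b), (False, a)]"
  have "run ws = letter False \<circ> act a \<circ> letter True \<circ> act b"
    by (simp add: ws_def fun_eq_iff step_def)
  moreover have "reduced ws"
    unfolding reduced_def
  proof (intro conjI allI impI)
    fix i assume "i < length ws"
    then have "i = 0 \<or> i = 1" by (auto simp: ws_def)
    then show "\<not> pinches (ws ! i) (ws ! (Suc i mod length ws))"
      using a b H by (auto simp: ws_def pinches_def)
  qed (use a b in \<open>auto simp: ws_def\<close>)
  ultimately show ?thesis using reduced_power_no_fixed_point[OF _ m p Y] by metis
qed

lemma countable_V:
  assumes X: "countable X" and G: "countable \<Gamma>" shows "countable V"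
proof -
  have "countable {p \<in> V. level p = n}" for n
  proof (induction n)
    case 0
    have "{p \<in> V. level p = 0} \<subseteq> Old ` X"
    proof
      fix p assume "p \<in> {p \<in> V. level p = 0}"
      then show "p \<in> Old ` X" by (cases p) (auto simp: Old_in_V)
    qed
    then show ?case by (rule countable_subset) (use X in simp)
  next
    case (Suc n)
    have "{p \<in> V. level p = Suc n}
        \<subseteq> (\<lambda>(e, g, p). New e g p) ` (UNIV \<times> \<Gamma> \<times> {p \<in> V. level p = n})"
    proof
      fix p assume "p \<in> {p \<in> V. level p = Suc n}"
      then obtain e g q where "p = New e g q" "level q = n" "p \<in> V" by (cases p) auto
      then show "p \<in> (\<lambda>(e, g, p). New e g p) ` (UNIV \<times> \<Gamma> \<times> {p \<in> V. level p = n})"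
        using New_in_V[of e g q] by (auto intro!: image_eqI[of _ _ "(e, g, q)"])
    qed
    moreover have "countable ((UNIV :: bool set) \<times> \<Gamma> \<times> {p \<in> V. level p = n})"
      using G Suc by (intro countable_SIGMA) simp_all
    ultimately show ?case by (rule countable_subset[OF _ countable_image])
  qed
  then have "countable (\<Union>n. {p \<in> V. level p = n})" by blast
  moreover have "(\<Union>n. {p \<in> V. level p = n}) = V" by auto
  ultimately show ?thesis by simp
qed

end

section \<open>The completed permutation group\<close>

lemma (in sharp_perm_group) countable_group:
  assumes "countable X" "x \<in> X" "y \<in> X" "x \<noteq> y"
  shows "countable \<Gamma>"
proof -
  have "inj_on (\<lambda>g. (g x, g y)) \<Gamma>"
    using eq_if_agree assms by (intro inj_onI) blast
  moreover have "(\<lambda>g. (g x, g y)) ` \<Gamma> \<subseteq> X \<times> X" using maps_to assms by auto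
  ultimately show ?thesis
    using assms(1) by (meson countable_SIGMA countable_image_inj_on countable_subset)
qed

text \<open>
  Makes room for the new points inside the given type: they go to every other element of a
  sequence outside \<open>X\<close>, so that infinitely many elements stay free for the next enlargement.
\<close>

lemma extend_injection:
  fixes V :: "'b set" and f :: "'a \<Rightarrow> 'b"
  assumes f: "inj f" "f ` X \<subseteq> V" and V: "countable V" and X: "infinite (- X)"
  obtains \<iota> :: "'b \<Rightarrow> 'a" where "inj_on \<iota> V" "\<And>x. x \<in> X \<Longrightarrow> \<iota> (f x) = x" "infinite (- \<iota> ` V)"
proof -
  obtain e :: "nat \<Rightarrow> 'a" where e: "inj e" "range e \<subseteq> - X"
    using infinite_countable_subset[OF X] by blast
  define \<iota> where "\<iota> p = (if p \<in> f ` X then inv_into UNIV f p else e (2 * to_nat_on V p))" for p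
  have old: "\<iota> (f x) = x" if "x \<in> X" for x using that f by (simp add: \<iota>_def)
  have new: "\<iota> p = e (2 * to_nat_on V p)" if "p \<notin> f ` X" for p using that by (simp add: \<iota>_def)
  have apart: "e n \<noteq> x" if "x \<in> X" for n x using e that by auto
  show thesis
  proof
    show "inj_on \<iota> V"
    proof (rule inj_onI)
      fix p q assume pq: "p \<in> V" "q \<in> V" "\<iota> p = \<iota> q"
      consider "p \<in> f ` X" "q \<in> f ` X" | "p \<in> f ` X" "q \<notin> f ` X" | "p \<notin> f ` X" "q \<in> f ` X"
        | "p \<notin> f ` X" "q \<notin> f ` X" by blast
      then show "p = q"
      proof cases
        case 1
        then show ?thesis using pq old by auto
      next
        case 2
        then show ?thesis using pq old new apart by fastforce
      next
        case 3
        then show ?thesis using pq old new apart by fastforce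
      next
        case 4
        then have "to_nat_on V p = to_nat_on V q" using pq new e(1) by (auto dest: injD)
        then show ?thesis using pq V by simp
      qed
    qed
    show "\<iota> (f x) = x" if "x \<in> X" for x using old that .
    have "range (\<lambda>n. e (Suc (2 * n))) \<subseteq> - \<iota> ` V"
    proof -
      have "e (Suc (2 * n)) \<noteq> \<iota> p" for n p
      proof (cases "p \<in> f ` X")
        case True
        then show ?thesis using old apart by auto
      next
        case False
        have "Suc (2 * n) \<noteq> 2 * to_nat_on V p" by presburger
        then show ?thesis using new[OF False] e(1) by (auto dest: injD)
      qed
      then show ?thesis by auto
    qed
    moreover have "inj (\<lambda>n. e (Suc (2 * n)))" using e(1) by (intro injI) (auto dest!: injD)
    ultimately show "infinite (- \<iota> ` V)"
      using range_inj_infinite infinite_super by blast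
  qed
qed

text \<open>
  The maps in \<open>W\<close> become permutations of a set that contains \<open>X\<close> itself. The last clause records the
  free action needed for simplicity in the case of a letter without relations and prescribed values.
\<close>

theorem (in partial_stable_letter) completion:
  assumes cX: "countable X" and iX: "infinite (- X)" and two: "x0 \<in> X" "y0 \<in> X" "x0 \<noteq> y0"
  obtains X' \<Gamma>' \<zeta> and L :: "('a \<Rightarrow> 'a) \<Rightarrow> 'a \<Rightarrow> 'a"
  where "sharp_perm_group X' \<Gamma>'" "countable X'" "infinite (- X')" "X \<subseteq> X'"
    "lifts X \<Gamma> \<Gamma>' L"
    "\<zeta> \<in> \<Gamma>'" "\<And>y. y \<in> Y True \<Longrightarrow> \<zeta> y = \<theta> True y"
    "\<And>h. h \<in> H True \<Longrightarrow> \<zeta> \<circ> L h = L (\<phi> True h) \<circ> \<zeta>"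
    "\<And>a b m x. \<lbrakk>\<And>e. H e = {id}; \<And>e. Y e = {}; a \<in> \<Gamma>; a \<noteq> id; b \<in> \<Gamma>; b \<noteq> id; m > 0; x \<in> X'\<rbrakk>
      \<Longrightarrow> ((pinv \<zeta> \<circ> L a \<circ> \<zeta> \<circ> L b) ^^ m) x \<noteq> x"
proof -
  have "countable V" using countable_V[OF cX countable_group[OF cX two]] .
  moreover have "inj Old" "Old ` X \<subseteq> V" by (auto simp: inj_def Old_in_V)
  ultimately obtain \<iota> where \<iota>: "inj_on \<iota> V" "\<And>x. x \<in> X \<Longrightarrow> \<iota> (Old x) = x" "infinite (- \<iota> ` V)"
    using extend_injection iX by metis
  define X' where "X' = \<iota> ` V"
  \<comment> \<open>Transport along \<open>\<iota>\<close>; the new points are moved into the type of the old ones.\<close>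
  define T where "T w n = (if n \<in> X' then \<iota> (w (inv_into V \<iota> n)) else n)" for w n
  have T: "T w (\<iota> p) = \<iota> (w p)" if "p \<in> V" for w p
    using that \<iota>(1) by (simp add: T_def X'_def)
  have T_out: "T w n = n" if "n \<notin> X'" for w n using that by (simp add: T_def)
  have eqI: "f = g" if "\<And>p. p \<in> V \<Longrightarrow> f (\<iota> p) = g (\<iota> p)" "\<And>n. n \<notin> X' \<Longrightarrow> f n = g n" for f g :: "'a \<Rightarrow> 'a"
  proof
    fix n show "f n = g n" using that by (cases "n \<in> X'") (auto simp: X'_def)
  qed
  have T_comp: "T (w \<circ> w') = T w \<circ> T w'" if "w' \<in> W" for w w'
    by (rule eqI) (use that W_V in \<open>simp_all add: T T_out\<close>)
  have T_cong: "T w = T c" if "\<And>p. p \<in> V \<Longrightarrow> w p = c p" for w c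
    by (rule eqI) (use that in \<open>simp_all add: T T_out\<close>)
  have T_id: "T id = id" by (rule eqI) (simp_all add: T T_out)
  have T_inj: "w p = p" if "w \<in> W" "p \<in> V" "T w (\<iota> p) = \<iota> p" for w p
  proof -
    have "\<iota> (w p) = \<iota> p" using that T by simp
    then show ?thesis using \<iota>(1) W_V[OF that(1,2)] that(2) by (auto dest: inj_onD)
  qed
  have inverse: "\<exists>w'\<in>W. T w \<circ> T w' = id \<and> T w' \<circ> T w = id \<and> pinv (T w) = T w'" if w: "w \<in> W" for w
  proof -
    obtain w' where w': "w' \<in> W" "\<forall>p\<in>V. w' (w p) = p \<and> w (w' p) = p" using W_inverse[OF w] by blast
    have "T w \<circ> T w' = T (w \<circ> w')" "T w' \<circ> T w = T (w' \<circ> w)" using T_comp w w' by auto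
    moreover have "T (w \<circ> w') = T id" "T (w' \<circ> w) = T id" using w' by (auto intro!: T_cong)
    ultimately have "T w \<circ> T w' = id" "T w' \<circ> T w = id" using T_id by auto
    then show ?thesis using w'(1) inv_unique_comp by blast
  qed
  have perm: "T w permutes X'" if w: "w \<in> W" for w
  proof -
    obtain w' where w': "w' \<in> W" "T w \<circ> T w' = id" "T w' \<circ> T w = id" using inverse[OF w] by blast
    have "T v n \<in> X'" if "v \<in> W" "n \<in> X'" for v n
      using that W_V T by (auto simp: X'_def)
    then have "bij_betw (T w) X' X'"
      using w w' by (intro bij_betw_byWitness[of _ "T w'"]) (auto simp: fun_eq_iff)
    then show ?thesis using T_out by (rule bij_imp_permutes)
  qed
  define \<Gamma>' where "\<Gamma>' = T ` W"
  have G': "sharp_perm_group X' \<Gamma>'"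
  proof
    fix g assume "g \<in> \<Gamma>'"
    then obtain w where w: "w \<in> W" "g = T w" by (auto simp: \<Gamma>'_def)
    show "g permutes X'" using w perm by simp
    show "pinv g \<in> \<Gamma>'" using inverse[OF w(1)] w by (auto simp: \<Gamma>'_def)
    show "g \<circ> h \<in> \<Gamma>'" if h: "h \<in> \<Gamma>'" for h
    proof -
      obtain v where v: "v \<in> W" "h = T v" using h by (auto simp: \<Gamma>'_def)
      then have "g \<circ> h = T (w \<circ> v)" using w T_comp by simp
      then show ?thesis using W_comp w v by (auto simp: \<Gamma>'_def)
    qed
    show "g = id" if xy: "x \<in> X'" "y \<in> X'" "x \<noteq> y" "g x = x" "g y = y" for x y
    proof -
      obtain p q where pq: "p \<in> V" "q \<in> V" "x = \<iota> p" "y = \<iota> q" using xy by (auto simp: X'_def)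
      then have "p \<noteq> q" "w p = p" "w q = q" using xy w T_inj by auto
      then have "w r = id r" if "r \<in> V" for r using W_sharp[OF w(1) pq(1,2)] that by simp
      then show ?thesis using T_cong[of w id] T_id w by simp
    qed
    show "g = id" if inv: "g \<circ> g = id" and x: "x \<in> X'" "g x = x" for x
    proof -
      obtain p where p: "p \<in> V" "x = \<iota> p" using x by (auto simp: X'_def)
      have wp: "w p = p" using p x w T_inj by auto
      have "w (w r) = r" if r: "r \<in> V" for r
      proof -
        have "T (w \<circ> w) (\<iota> r) = \<iota> r" using inv w T_comp by simp
        then show ?thesis using T_inj[OF W_comp[OF w(1) w(1)] r] by simp
      qed
      then have "w r = id r" if "r \<in> V" for r
        using W_involution[OF w(1) _ p(1) wp that two] by simp
      then show ?thesis using T_cong[of w id] T_id w by simp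
    qed
  next
    show "id \<in> \<Gamma>'" using T_id W.id by (metis \<Gamma>'_def imageI)
  qed
  define L where "L g = T (act g)" for g
  define \<zeta> where "\<zeta> = T (letter True)"
  show thesis
  proof (rule that[OF G'])
    show "countable X'" using \<open>countable V\<close> by (simp add: X'_def)
    show "infinite (- X')" using \<iota> by (simp add: X'_def)
    show "X \<subseteq> X'"
    proof
      fix x assume x: "x \<in> X"
      then have "\<iota> (Old x) \<in> X'" by (simp add: X'_def Old_in_V)
      then show "x \<in> X'" using \<iota>(2)[OF x] by simp
    qed
    have "L g \<in> \<Gamma>'" if "g \<in> \<Gamma>" for g using act_W[OF that] by (simp add: L_def \<Gamma>'_def)
    moreover have "L g x = g x" if "g \<in> \<Gamma>" "x \<in> X" for g x
      using T[of "Old x" "act g"] \<iota>(2) maps_to that by (simp add: L_def Old_in_V)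
    ultimately show "lifts X \<Gamma> \<Gamma>' L" by (simp add: lifts_def)
    show "\<zeta> \<in> \<Gamma>'" using letter_W by (simp add: \<zeta>_def \<Gamma>'_def)
    show "\<zeta> y = \<theta> True y" if y: "y \<in> Y True" for y
    proof -
      have "y \<in> X" "\<theta> True y \<in> X" using Y_sub[OF y] Y_sub[OF \<theta>_in[OF y]] .
      then show ?thesis
        using T[of "Old y" "letter True"] \<iota>(2) letter_Old[OF y] by (simp add: \<zeta>_def Old_in_V)
    qed
    show "\<zeta> \<circ> L h = L (\<phi> True h) \<circ> \<zeta>" if h: "h \<in> H True" for h
    proof -
      have "act h \<in> W" using act_W H_sub h by blast
      then have "\<zeta> \<circ> L h = T (letter True \<circ> act h)" "L (\<phi> True h) \<circ> \<zeta> = T (act (\<phi> True h) \<circ> letter True)"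
        using T_comp letter_W by (auto simp: \<zeta>_def L_def)
      moreover have "T (letter True \<circ> act h) = T (act (\<phi> True h) \<circ> letter True)"
        using letter_act[OF _ h] by (auto intro!: T_cong)
      ultimately show ?thesis by simp
    qed
    show "((pinv \<zeta> \<circ> L a \<circ> \<zeta> \<circ> L b) ^^ m) x \<noteq> x"
      if H: "\<And>e. H e = {id}" and Y: "\<And>e. Y e = {}" and a: "a \<in> \<Gamma>" "a \<noteq> id" and b: "b \<in> \<Gamma>" "b \<noteq> id"
        and m: "m > 0" and x: "x \<in> X'" for a b m x
    proof -
      define w where "w = letter False \<circ> act a \<circ> letter True \<circ> act b"
      have W: "act a \<in> W" "act b \<in> W" "w \<in> W" using act_W letter_W W_comp a b by (auto simp: w_def)
      have "T (letter False) \<circ> \<zeta> = T (letter False \<circ> letter True)" "\<zeta> \<circ> T (letter False) = T (letter True \<circ> letter False)"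
        using T_comp letter_W by (auto simp: \<zeta>_def)
      moreover have "T (letter False \<circ> letter True) = T id" "T (letter True \<circ> letter False) = T id"
        using letter_letter[of _ True] letter_letter[of _ False] by (auto intro!: T_cong)
      ultimately have "pinv \<zeta> = T (letter False)" using T_id by (intro inv_unique_comp) auto
      then have eq: "pinv \<zeta> \<circ> L a \<circ> \<zeta> \<circ> L b = T w"
        using T_comp W letter_W by (simp add: w_def \<zeta>_def L_def)
      obtain p where p: "p \<in> V" "x = \<iota> p" using x by (auto simp: X'_def)
      have "(w ^^ k) p \<in> V \<and> (T w ^^ k) x = \<iota> ((w ^^ k) p)" for k
        by (induction k) (use p T W_V[OF W(3)] in auto)
      moreover have "(w ^^ m) p \<noteq> p"
        using alternating_word_no_fixed_point[OF a b H Y m p(1)] by (simp add: w_def)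
      ultimately show ?thesis using eq p \<iota>(1) by (metis inj_onD)
    qed
  qed
qed

section \<open>Conjugating free elements\<close>

text \<open>
  Gives access to integer powers and normal subgroups.
\<close>

definition perm_group :: "('a \<Rightarrow> 'a) set \<Rightarrow> ('a \<Rightarrow> 'a) monoid" where
  "perm_group \<Gamma> = \<lparr>carrier = \<Gamma>, monoid.mult = (\<circ>), one = id\<rparr>"

lemma perm_group_simps [simp]:
  "carrier (perm_group \<Gamma>) = \<Gamma>" "f \<otimes>\<^bsub>perm_group \<Gamma>\<^esub> g = f \<circ> g" "\<one>\<^bsub>perm_group \<Gamma>\<^esub> = id"
  by (simp_all add: perm_group_def)

context sharp_perm_group
begin

lemma group_perm_group: "group (perm_group \<Gamma>)"
proof (rule groupI)
  fix g assume "g \<in> carrier (perm_group \<Gamma>)"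
  then show "\<exists>h\<in>carrier (perm_group \<Gamma>). h \<otimes>\<^bsub>perm_group \<Gamma>\<^esub> g = \<one>\<^bsub>perm_group \<Gamma>\<^esub>"
    using pinv_mem pinv_left by (intro bexI[of _ "pinv g"]) simp_all
qed (simp_all add: comp_mem id_mem comp_assoc)

lemma inv_perm_group: "g \<in> \<Gamma> \<Longrightarrow> inv\<^bsub>perm_group \<Gamma>\<^esub> g = pinv g"
  using group.inv_equality[OF group_perm_group, of "pinv g" g] by (simp add: pinv_mem pinv_left)

definition zpow :: "('a \<Rightarrow> 'a) \<Rightarrow> int \<Rightarrow> 'a \<Rightarrow> 'a" where
  "zpow g k = g [^]\<^bsub>perm_group \<Gamma>\<^esub> k"

lemma zpow_mem: "g \<in> \<Gamma> \<Longrightarrow> zpow g k \<in> \<Gamma>"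
  using group.int_pow_closed[OF group_perm_group, of g k] by (simp add: zpow_def)

lemma zpow_add: "g \<in> \<Gamma> \<Longrightarrow> zpow g (i + j) = zpow g i \<circ> zpow g j"
  using group.int_pow_mult[OF group_perm_group, of g i j] by (simp add: zpow_def)

lemma zpow_0 [simp]: "zpow g 0 = id"
  by (simp add: zpow_def int_pow_def2)

lemma zpow_1: "g \<in> \<Gamma> \<Longrightarrow> zpow g 1 = g"
  using group.int_pow_1[OF group_perm_group, of g] by (simp add: zpow_def)

lemma zpow_of_nat: "zpow g (int n) = g ^^ n"
proof -
  have "g [^]\<^bsub>perm_group \<Gamma>\<^esub> n = g ^^ n"
    by (induction n) (simp_all add: nat_pow_def perm_group_def funpow_Suc_right del: funpow.simps)
  then show ?thesis by (simp add: zpow_def int_pow_int)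
qed

lemma pinv_zpow: "g \<in> \<Gamma> \<Longrightarrow> pinv (zpow g k) = zpow g (- k)"
  using zpow_add[of g k "- k"] zpow_add[of g "- k" k] by (intro inv_unique_comp) simp_all

definition acts_freely :: "('a \<Rightarrow> 'a) \<Rightarrow> bool" where
  "acts_freely g \<longleftrightarrow> (\<forall>m>0. \<forall>x\<in>X. (g ^^ m) x \<noteq> x)"

lemma zpow_fixed_point:
  assumes g: "g \<in> \<Gamma>" "acts_freely g" and x: "x \<in> X" "zpow g k x = x"
  shows "k = 0"
proof (rule ccontr)
  assume "k \<noteq> 0"
  have "zpow g (- k) x = zpow g (- k) (zpow g k x)" using x by simp
  also have "\<dots> = zpow g (- k + k) x" by (simp only: zpow_add[OF g(1)] comp_apply)
  finally have "zpow g (- k) x = x" by simp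
  then have "zpow g (int (nat \<bar>k\<bar>)) x = x" using x by (simp add: abs_if)
  moreover have "nat \<bar>k\<bar> > 0" using \<open>k \<noteq> 0\<close> by simp
  ultimately show False using g(2) x(1) zpow_of_nat by (metis acts_freely_def)
qed

lemma zpow_inj:
  assumes g: "g \<in> \<Gamma>" "acts_freely g" and x: "x \<in> X"
  shows "zpow g i = zpow g j \<longleftrightarrow> i = j"
proof
  assume eq: "zpow g i = zpow g j"
  have "zpow g (i - j) = zpow g i \<circ> zpow g (- j)" using zpow_add[OF g(1), of i "- j"] by simp
  also have "\<dots> = zpow g (j + - j)" using zpow_add[OF g(1), of j "- j"] eq by simp
  finally have "zpow g (i - j) x = x" by simp
  then show "i = j" using zpow_fixed_point[OF g x, of "i - j"] by simp
qed simp

text \<open>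
  Two elements all of whose positive powers act without fixed points generate infinite cyclic
  groups acting freely on \<open>X\<close>, so they may serve as \<open>H\<close> and \<open>K\<close>, with no values prescribed.
\<close>

theorem conjugate_free_elements:
  assumes cX: "countable X" and iX: "infinite (- X)" and two: "x0 \<in> X" "y0 \<in> X" "x0 \<noteq> y0"
    and p: "p \<in> \<Gamma>" "acts_freely p" and q: "q \<in> \<Gamma>" "acts_freely q"
  obtains X' \<Gamma>' v and L :: "('a \<Rightarrow> 'a) \<Rightarrow> 'a \<Rightarrow> 'a"
  where "sharp_perm_group X' \<Gamma>'" "countable X'" "infinite (- X')" "X \<subseteq> X'"
    "lifts X \<Gamma> \<Gamma>' L"
    "v \<in> \<Gamma>'" "v \<circ> L p = L q \<circ> v"
proof -
  define u where "u e = (if e then p else q)" for e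
  have u: "u e \<in> \<Gamma>" "acts_freely (u e)" for e using p q by (simp_all add: u_def)
  define H where "H e = range (zpow (u e))" for e
  define \<phi> where "\<phi> e h = zpow (u (\<not> e)) (THE k. h = zpow (u e) k)" for e h
  have \<phi>: "\<phi> e (zpow (u e) k) = zpow (u (\<not> e)) k" for e k
    using zpow_inj[OF u two(1)] by (simp add: \<phi>_def)
  interpret partial_stable_letter X \<Gamma> H \<phi> "\<lambda>e. {}" "\<lambda>e. id"
  proof
    fix e h assume "h \<in> H e"
    then obtain k where k: "h = zpow (u e) k" by (auto simp: H_def)
    show "h \<in> \<Gamma>" using k u zpow_mem by simp
    show "pinv h \<in> H e" using k u pinv_zpow by (simp add: H_def)
    show "\<phi> e h \<in> H (\<not> e)" using k \<phi> by (simp add: H_def)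
    show "\<phi> (\<not> e) (\<phi> e h) = h" using k \<phi>[of e] \<phi>[of "\<not> e"] by simp
    show "h = id" if "x \<in> X" "h x = x" for x using zpow_fixed_point[OF u that(1)] that k by fastforce
    fix h' assume "h' \<in> H e"
    then obtain k' where k': "h' = zpow (u e) k'" by (auto simp: H_def)
    have hh': "h \<circ> h' = zpow (u e) (k + k')" using k k' u zpow_add by simp
    show "h \<circ> h' \<in> H e" unfolding hh' H_def by (rule rangeI)
    show "\<phi> e (h \<circ> h') = \<phi> e h \<circ> \<phi> e h'"
      unfolding hh' unfolding k k' \<phi> by (rule zpow_add[OF u(1)])
  next
    show "id \<in> H e" for e by (metis H_def rangeI zpow_0)
  qed simp_all
  obtain X' \<Gamma>' \<zeta> and L :: "('a \<Rightarrow> 'a) \<Rightarrow> 'a \<Rightarrow> 'a" where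
    c: "sharp_perm_group X' \<Gamma>'" "countable X'" "infinite (- X')" "X \<subseteq> X'"
    "lifts X \<Gamma> \<Gamma>' L"
    "\<zeta> \<in> \<Gamma>'" "\<And>h. h \<in> H True \<Longrightarrow> \<zeta> \<circ> L h = L (\<phi> True h) \<circ> \<zeta>"
    by (rule completion[OF cX iX two]) blast
  have "p \<in> H True" by (metis H_def p(1) rangeI u_def zpow_1)
  moreover have "\<phi> True p = q"
    using \<phi>[of True 1] p q zpow_1 by (simp add: u_def)
  ultimately show thesis using that[OF c(1-6)] c(7)[of p] by simp
qed

theorem adjoin_free_letter:
  assumes cX: "countable X" and iX: "infinite (- X)" and two: "x0 \<in> X" "y0 \<in> X" "x0 \<noteq> y0"
  obtains X' \<Gamma>' \<zeta> and L :: "('a \<Rightarrow> 'a) \<Rightarrow> 'a \<Rightarrow> 'a"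
  where "sharp_perm_group X' \<Gamma>'" "countable X'" "infinite (- X')" "X \<subseteq> X'"
    "lifts X \<Gamma> \<Gamma>' L"
    "\<zeta> \<in> \<Gamma>'"
    "\<And>a b. \<lbrakk>a \<in> \<Gamma>; a \<noteq> id; b \<in> \<Gamma>; b \<noteq> id\<rbrakk>
      \<Longrightarrow> sharp_perm_group.acts_freely X' (pinv \<zeta> \<circ> L a \<circ> \<zeta> \<circ> L b)"
proof -
  interpret partial_stable_letter X \<Gamma> "\<lambda>e. {id}" "\<lambda>e h. h" "\<lambda>e. {}" "\<lambda>e. id"
    by unfold_locales (simp_all add: id_mem)
  show thesis
  proof (rule completion[OF cX iX two], goal_cases)
    case (1 X' \<Gamma>' \<zeta> L)
    show thesis
    proof (rule that[OF 1(1-6)])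
      show "sharp_perm_group.acts_freely X' (pinv \<zeta> \<circ> L a \<circ> \<zeta> \<circ> L b)"
        if "a \<in> \<Gamma>" "a \<noteq> id" "b \<in> \<Gamma>" "b \<noteq> id" for a b
        unfolding sharp_perm_group.acts_freely_def[OF 1(1)] using 1(9)[OF refl refl that] by blast
    qed
  qed
qed

end

section \<open>One-step extensions\<close>

text \<open>
  Prescribe \<open>x0 \<mapsto> a\<close> and \<open>y0 \<mapsto> b\<close>. As \<open>t\<close> swaps \<open>x0\<close> and \<open>y0\<close>, no element of \<open>\<Gamma>\<close> moves
  \<open>(x0, y0)\<close> to \<open>(b, a)\<close> either, which is the condition \<open>no_transfer\<close>. The setwise
  stabilizer of \<open>{a, b}\<close> has at most two elements and has to be contained in \<open>H False\<close>, so \<open>t\<close> is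
  conjugated to the involution that swaps \<open>a\<close> and \<open>b\<close> if there is one. Both groups act freely since involutions have no fixed points.
\<close>

theorem (in sharp_perm_group) adjoin_transporter:
  assumes cX: "countable X" and iX: "infinite (- X)"
    and t: "t \<in> \<Gamma>" "t x0 = y0" "t y0 = x0" and x0: "x0 \<in> X" "x0 \<noteq> y0"
    and ab: "a \<in> X" "b \<in> X" "a \<noteq> b"
    and none: "\<And>g. g \<in> \<Gamma> \<Longrightarrow> g x0 = a \<Longrightarrow> g y0 = b \<Longrightarrow> False"
  obtains X' \<Gamma>' \<zeta> and L :: "('a \<Rightarrow> 'a) \<Rightarrow> 'a \<Rightarrow> 'a"
  where "sharp_perm_group X' \<Gamma>'" "countable X'" "infinite (- X')" "X \<subseteq> X'"
    "lifts X \<Gamma> \<Gamma>' L"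
    "\<zeta> \<in> \<Gamma>'" "\<zeta> x0 = a" "\<zeta> y0 = b"
proof -
  have y0: "y0 \<in> X" using maps_to[OF t(1) x0(1)] t by simp
  have none': False if "g \<in> \<Gamma>" "g x0 = b" "g y0 = a" for g
    using none[of "g \<circ> t"] comp_mem that t by simp
  have involution: "s \<circ> s = id" if "s \<in> \<Gamma>" "s x = y" "s y = x" "x \<in> X" "y \<in> X" "x \<noteq> y" for s x y
    by (rule sharp[of _ x y]) (use that comp_mem in auto)
  \<comment> \<open>\<open>u\<close> is the pair \<open>t, s\<close> if some \<open>s\<close> swaps \<open>a\<close> and \<open>b\<close>, and trivial otherwise.\<close>
  obtain u where u: "\<And>e. u e \<in> \<Gamma>" "\<And>e. u e \<circ> u e = id"
    and base: "u True x0 = x0 \<and> u True y0 = y0 \<or> u True x0 = y0 \<and> u True y0 = x0"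
    and swaps: "\<And>s. s \<in> \<Gamma> \<Longrightarrow> s a = b \<Longrightarrow> s b = a \<Longrightarrow> s = u False"
    and same: "u True x0 = y0 \<longleftrightarrow> u False a = b" "u True x0 = x0 \<longleftrightarrow> u False a = a"
      "u False a = a \<and> u False b = b \<or> u False a = b \<and> u False b = a"
  proof (cases "\<exists>s\<in>\<Gamma>. s a = b \<and> s b = a")
    case True
    then obtain s where s: "s \<in> \<Gamma>" "s a = b" "s b = a" by blast
    have sq: "t \<circ> t = id" "s \<circ> s = id"
      by (rule involution[OF t x0(1) y0 x0(2)], rule involution[OF s ab])
    show thesis
    proof (rule that[of "\<lambda>e. if e then t else s"])
      show "s' = (if False then t else s)" if "s' \<in> \<Gamma>" "s' a = b" "s' b = a" for s'
        using eq_if_agree[OF that(1) s(1) ab] that s by simp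
    qed (use s t sq x0 ab in simp_all)
  next
    case False
    show thesis by (rule that[of "\<lambda>e. id"]) (use False x0 ab id_mem in \<open>simp_all, blast?\<close>)
  qed
  define H where "H e = {id, u e}" for e
  define \<phi> where "\<phi> e h = (if h = id then id else u (\<not> e))" for e and h :: "'a \<Rightarrow> 'a"
  define Y where "Y e = (if e then {x0, y0} else {a, b})" for e
  define \<theta> where "\<theta> e x = (if e then (if x = x0 then a else b) else (if x = a then x0 else y0))" for e x
  have u_id: "u e = id \<longleftrightarrow> u (\<not> e) = id" for e
  proof -
    have "u True = id \<longleftrightarrow> u True x0 = x0"
      using sharp[OF u(1) x0(1) y0 x0(2)] base x0 by auto
    moreover have "u False = id \<longleftrightarrow> u False a = a"
      using sharp[OF u(1) ab] same ab by auto
    ultimately show ?thesis using same by (cases e) auto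
  qed
  have pinv_u: "pinv (u e) = u e" for e using u(2) by (intro inv_unique_comp)
  interpret partial_stable_letter X \<Gamma> H \<phi> Y \<theta>
  proof
    fix e h assume h: "h \<in> H e"
    show "h \<in> \<Gamma>" using h u id_mem by (auto simp: H_def)
    have hh: "h \<circ> h = id" using h u by (auto simp: H_def)
    show "pinv h \<in> H e" using h pinv_u by (auto simp: H_def)
    show "\<phi> e h \<in> H (\<not> e)" by (auto simp: H_def \<phi>_def)
    show "\<phi> (\<not> e) (\<phi> e h) = h" using h u_id[of e] by (auto simp: H_def \<phi>_def)
    show "h = id" if "x \<in> X" "h x = x" for x
      using involution_free[OF \<open>h \<in> \<Gamma>\<close> hh that] .
    show "h y \<in> Y e" if "y \<in> Y e" for y
      using that h base same(3) by (auto simp: H_def Y_def split: if_splits)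
    show "\<theta> e (h y) = \<phi> e h (\<theta> e y)" if "y \<in> Y e" for y
    proof (cases "h = id")
      case True
      then show ?thesis by (simp add: \<phi>_def)
    next
      case False
      then have h: "h = u e" "u e \<noteq> id" using h by (auto simp: H_def)
      have "u True x0 = y0 \<and> u True y0 = x0 \<and> u False a = b \<and> u False b = a"
      proof -
        have "u True \<noteq> id" using h(2) u_id[of True] by (cases e) simp_all
        then have "u True x0 \<noteq> x0" 
          using sharp[OF u(1)[of True] x0(1) y0 x0(2)] base x0(2) by metis
        then have x: "u True x0 = y0 \<and> u True y0 = x0" using base by blast
        then have "u False a = b" using same(1) by blast
        then show ?thesis using x same(3) ab(3) by metis
      qed
      then show ?thesis
        using that x0(2) ab(3) h(2) unfolding h(1) Y_def \<theta>_def \<phi>_def by (cases e) auto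
    qed
    fix k assume k: "k \<in> H e"
    show "h \<circ> k \<in> H e" using h k u by (auto simp: H_def)
    show "\<phi> e (h \<circ> k) = \<phi> e h \<circ> \<phi> e k" using h k u by (auto simp: H_def \<phi>_def)
  next
    show "id \<in> H e" for e by (simp add: H_def)
    show "y \<in> X" if "y \<in> Y e" for y e using that x0 y0 ab by (auto simp: Y_def split: if_splits)
    show "\<theta> e y \<in> Y (\<not> e)" for y e by (simp add: Y_def \<theta>_def)
    show "\<theta> (\<not> e) (\<theta> e y) = y" if "y \<in> Y e" for y e
      using that x0 ab by (auto simp: Y_def \<theta>_def split: if_splits)
    show False if "g \<in> \<Gamma>" "y \<in> Y True" "y' \<in> Y True" "y \<noteq> y'" "g y \<in> Y False" "g y' \<in> Y False" for g y y'
    proof -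
      have "g y \<noteq> g y'" using inj_mem[OF that(1)] that(4) by simp
      then have "g x0 = a \<and> g y0 = b \<or> g x0 = b \<and> g y0 = a" using that by (auto simp: Y_def)
      then show False using none none' that(1) by blast
    qed
    show "g \<in> H False"
      if "g \<in> \<Gamma>" "y \<in> Y False" "y' \<in> Y False" "y \<noteq> y'" "g y \<in> Y False" "g y' \<in> Y False" for g y y'
    proof -
      have "g y \<noteq> g y'" using inj_mem[OF that(1)] that(4) by simp
      then have "g a = a \<and> g b = b \<or> g a = b \<and> g b = a" using that by (auto simp: Y_def)
      then show ?thesis using sharp[OF that(1) ab] swaps[OF that(1)] by (auto simp: H_def)
    qed
  qed
  have "x0 \<in> Y True" "y0 \<in> Y True" "\<theta> True x0 = a" "\<theta> True y0 = b"
    using x0 by (simp_all add: Y_def \<theta>_def)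
  show thesis
  proof (rule completion[OF cX iX x0(1) y0 x0(2)], goal_cases)
    case (1 X' \<Gamma>' \<zeta> L)
    show thesis
      by (rule that[OF 1(1-6)])
        (use 1(7)[OF \<open>x0 \<in> Y True\<close>] 1(7)[OF \<open>y0 \<in> Y True\<close>] \<open>\<theta> True x0 = a\<close> \<open>\<theta> True y0 = b\<close> in simp_all)
  qed
qed

text \<open>
  Both sides agree on \<open>X\<close>, and two points determine an element of the larger group.
\<close>

lemma (in sharp_perm_group) lift_hom:
  assumes G': "sharp_perm_group X' \<Gamma>'" and sub: "X \<subseteq> X'" and two: "x0 \<in> X" "y0 \<in> X" "x0 \<noteq> y0"
    and L: "lifts X \<Gamma> \<Gamma>' L"
    and f: "f \<in> \<Gamma>"
  shows "g \<in> \<Gamma> \<Longrightarrow> L (f \<circ> g) = L f \<circ> L g" and "L (pinv f) = pinv (L f)"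
proof -
  interpret G': sharp_perm_group X' \<Gamma>' by (rule G')
  have two': "x0 \<in> X'" "y0 \<in> X'" using two sub by auto
  show "L (f \<circ> g) = L f \<circ> L g" if g: "g \<in> \<Gamma>"
    by (rule G'.eq_if_agree[OF _ _ two' two(3)])
      (use f g two in \<open>simp_all add: lifts_mem[OF L] lifts_eq[OF L] maps_to comp_mem G'.comp_mem\<close>)
  have "pinv (L f) x = pinv f x" if "x \<in> X" for x
  proof -
    have "L f (pinv f x) = x" 
      using f that by (simp add: lifts_eq[OF L] pinv_mem maps_to pinv_right_apply)
    then show ?thesis using G'.pinv_left_apply[OF lifts_mem[OF L f]] by metis
  qed
  then show "L (pinv f) = pinv (L f)"
    by (intro G'.eq_if_agree[OF _ _ two' two(3)])
      (use f two in \<open>simp_all add: lifts_mem[OF L] lifts_eq[OF L] pinv_mem G'.pinv_mem\<close>)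
qed

text \<open>
  A condition on \<open>\<Gamma>\<close> that puts \<open>h\<close> into the normal closure of \<open>g\<close> and, being an existential
  equation, survives every extension. With \<open>p = z\<^sup>-\<^sup>1 g z g\<^sup>-\<^sup>1\<close> it reads \<open>v p v\<^sup>-\<^sup>1 = p h\<close>.
\<close>

definition derives :: "('a \<Rightarrow> 'a) set \<Rightarrow> ('a \<Rightarrow> 'a) \<Rightarrow> ('a \<Rightarrow> 'a) \<Rightarrow> bool" where
  "derives \<Gamma> g h \<longleftrightarrow> h = g \<or>
     (\<exists>z\<in>\<Gamma>. \<exists>v\<in>\<Gamma>. v \<circ> (pinv z \<circ> g \<circ> z \<circ> pinv g) = (pinv z \<circ> g \<circ> z \<circ> pinv g) \<circ> h \<circ> v)"

lemma (in sharp_perm_group) derives_lift: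
  assumes G': "sharp_perm_group X' \<Gamma>'" and sub: "X \<subseteq> X'" and two: "x0 \<in> X" "y0 \<in> X" "x0 \<noteq> y0"
    and L: "lifts X \<Gamma> \<Gamma>' L"
    and gh: "g \<in> \<Gamma>" "h \<in> \<Gamma>" and der: "derives \<Gamma> g h"
  shows "derives \<Gamma>' (L g) (L h)"
proof (cases "h = g")
  case False
  then obtain z v where zv: "z \<in> \<Gamma>" "v \<in> \<Gamma>"
    and eq: "v \<circ> (pinv z \<circ> g \<circ> z \<circ> pinv g) = (pinv z \<circ> g \<circ> z \<circ> pinv g) \<circ> h \<circ> v"
    using der by (auto simp: derives_def)
  note hom = lift_hom[OF G' sub two L]
  have "L (v \<circ> (pinv z \<circ> g \<circ> z \<circ> pinv g)) = L ((pinv z \<circ> g \<circ> z \<circ> pinv g) \<circ> h \<circ> v)"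
    using eq by simp
  then have "L v \<circ> (pinv (L z) \<circ> L g \<circ> L z \<circ> pinv (L g))
      = (pinv (L z) \<circ> L g \<circ> L z \<circ> pinv (L g)) \<circ> L h \<circ> L v"
    using gh zv by (simp add: hom comp_mem pinv_mem del: o_apply)
  then show ?thesis using lifts_mem[OF L] zv unfolding derives_def by blast
qed (simp add: derives_def)

text \<open>
  With a free letter \<open>z\<close>, both \<open>p\<close> and \<open>p h = z\<^sup>-\<^sup>1 g z (g\<^sup>-\<^sup>1 h)\<close> are alternating words in the sense above. The case
  \<open>h = g\<close>, in which the last syllable is trivial, needs no extension.
\<close>

theorem (in sharp_perm_group) adjoin_derivation:
  assumes cX: "countable X" and iX: "infinite (- X)" and two: "x0 \<in> X" "y0 \<in> X" "x0 \<noteq> y0"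
    and g: "g \<in> \<Gamma>" "g \<noteq> id" and h: "h \<in> \<Gamma>"
  obtains X' \<Gamma>' and L :: "('a \<Rightarrow> 'a) \<Rightarrow> 'a \<Rightarrow> 'a"
  where "sharp_perm_group X' \<Gamma>'" "countable X'" "infinite (- X')" "X \<subseteq> X'"
    "lifts X \<Gamma> \<Gamma>' L"
    "derives \<Gamma>' (L g) (L h)"
proof (cases "h = g")
  case True
  show thesis
    by (rule that[of X \<Gamma> "\<lambda>g. g"])
      (use sharp_perm_group_axioms cX iX True in \<open>simp_all add: derives_def lifts_def\<close>)
next
  case False
  show thesis
  proof (rule adjoin_free_letter[OF cX iX two], goal_cases)
    case (1 X1 \<Gamma>1 \<zeta> L1)
    interpret G1: sharp_perm_group X1 \<Gamma>1 by (rule 1(1))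
    note L1 = 1(5)
    note hom1 = lift_hom[OF 1(1,4) two L1]
    have two1: "x0 \<in> X1" "y0 \<in> X1" using two 1(4) by auto
    have ne: "pinv g \<noteq> id" "pinv g \<circ> h \<noteq> id"
      using eq_if_pinv_comp_id[OF g(1)] False g pinv_left[OF g(1)] by (auto simp: id_comp)
    define p where "p = pinv \<zeta> \<circ> L1 g \<circ> \<zeta> \<circ> pinv (L1 g)"
    have p: "p = pinv \<zeta> \<circ> L1 g \<circ> \<zeta> \<circ> L1 (pinv g)" using hom1(2) g by (simp add: p_def)
    have q: "p \<circ> L1 h = pinv \<zeta> \<circ> L1 g \<circ> \<zeta> \<circ> L1 (pinv g \<circ> h)"
      using hom1(1)[OF pinv_mem[OF g(1)] h] by (simp add: p comp_assoc)
    have free: "G1.acts_freely p" "G1.acts_freely (p \<circ> L1 h)"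
      unfolding q unfolding p using 1(7) g ne pinv_mem comp_mem h by auto
    have mem: "p \<in> \<Gamma>1" "p \<circ> L1 h \<in> \<Gamma>1"
      using 1(6) lifts_mem[OF L1] g h pinv_mem by (auto simp: p_def intro!: G1.comp_mem G1.pinv_mem)
    show thesis
    proof (rule G1.conjugate_free_elements[OF 1(2,3) two1 two(3) mem(1) free(1) mem(2) free(2)], goal_cases)
      case (1 X2 \<Gamma>2 v L2)
      note step2 = 1
      note L2 = 1(5)
      note hom2 = G1.lift_hom[OF 1(1,4) two1 two(3) L2]
      have mem1: "\<zeta> \<in> \<Gamma>1" "L1 g \<in> \<Gamma>1" "L1 h \<in> \<Gamma>1"
        using \<open>\<zeta> \<in> \<Gamma>1\<close> lifts_mem[OF L1] g h by auto
      have "L2 p = pinv (L2 \<zeta>) \<circ> L2 (L1 g) \<circ> L2 \<zeta> \<circ> pinv (L2 (L1 g))"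
        unfolding p_def using mem1 by (simp add: hom2 G1.comp_mem G1.pinv_mem del: o_apply)
      moreover have "L2 (p \<circ> L1 h) = L2 p \<circ> L2 (L1 h)" using hom2(1) mem mem1 by blast
      ultimately have "derives \<Gamma>2 (L2 (L1 g)) (L2 (L1 h))"
        unfolding derives_def using 1(6,7) lifts_mem[OF L2 mem1(1)] by metis
      then show thesis
        using \<open>X \<subseteq> X1\<close> \<open>X1 \<subseteq> X2\<close> L1 L2
        by (intro that[of X2 \<Gamma>2 "\<lambda>f. L2 (L1 f)"] step2(1-3)) (auto simp: lifts_def)
    qed
  qed
qed

section \<open>Unions of chains\<close>

definition on_set :: "('a \<Rightarrow> 'a) \<Rightarrow> 'a set \<Rightarrow> 'a \<Rightarrow> 'a" where
  "on_set f A x = (if x \<in> A then f x else x)"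

locale sharp_chain =
  fixes X :: "nat \<Rightarrow> 'a set" and \<Gamma> :: "nat \<Rightarrow> ('a \<Rightarrow> 'a) set" and x0 y0 :: 'a
  assumes sharp_group: "sharp_perm_group (X n) (\<Gamma> n)"
    and chain: "extends (X n) (\<Gamma> n) (X (Suc n)) (\<Gamma> (Suc n))"
    and base: "x0 \<in> X n" "y0 \<in> X n" "x0 \<noteq> y0"
begin

definition limit_set :: "'a set" where
  "limit_set = (\<Union>n. X n)"

text \<open>
  An element of the union acts on all sufficiently late stages as an element of the group at that stage.
  It need not preserve the early stages.
\<close>

definition limit_group :: "('a \<Rightarrow> 'a) set" where
  "limit_group = {f. (\<forall>x. x \<notin> limit_set \<longrightarrow> f x = x) \<and> (\<exists>n. \<forall>m\<ge>n. on_set f (X m) \<in> \<Gamma> m)}"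

lemma extends_le: "n \<le> m \<Longrightarrow> extends (X n) (\<Gamma> n) (X m) (\<Gamma> m)"
proof (induction m rule: dec_induct)
  case (step m)
  then show ?case using chain extends_trans by blast
qed (rule extends_refl)

lemma X_mono: "n \<le> m \<Longrightarrow> X n \<subseteq> X m"
  using extends_le by (auto simp: extends_def)

lemma X_limit: "x \<in> X n \<Longrightarrow> x \<in> limit_set"
  by (auto simp: limit_set_def)

lemma eventually_in_X:
  assumes "x \<in> limit_set" obtains m where "m \<ge> n" "x \<in> X m"
proof -
  obtain k where "x \<in> X k" using assms by (auto simp: limit_set_def)
  then have "x \<in> X (max n k)" using X_mono[of k "max n k"] by auto
  then show thesis using that[of "max n k"] by simp
qed

lemma on_set_eq: "x \<in> X m \<Longrightarrow> on_set f (X m) x = f x"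
  by (simp add: on_set_def)

lemma limit_memE:
  assumes "f \<in> limit_group" obtains n where "\<And>m. m \<ge> n \<Longrightarrow> on_set f (X m) \<in> \<Gamma> m"
  using assms by (auto simp: limit_group_def)

lemma limit_maps_to: "on_set f (X m) \<in> \<Gamma> m \<Longrightarrow> x \<in> X m \<Longrightarrow> f x \<in> X m"
  using sharp_perm_group.maps_to[OF sharp_group, of "on_set f (X m)" m x] by (simp add: on_set_eq)

lemma limit_eq_idI:
  assumes f: "f \<in> limit_group" and id: "\<And>m. m \<ge> n \<Longrightarrow> on_set f (X m) = id"
  shows "f = id"
proof
  fix x
  show "f x = id x"
  proof (cases "x \<in> limit_set")
    case True
    then obtain m where m: "m \<ge> n" "x \<in> X m" by (rule eventually_in_X)
    then have "f x = on_set f (X m) x" by (simp add: on_set_eq)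
    then show ?thesis using id[OF m(1)] by simp
  qed (use f in \<open>simp add: limit_group_def\<close>)
qed

lemma on_set_comp:
  assumes "on_set g (X m) \<in> \<Gamma> m"
  shows "on_set (f \<circ> g) (X m) = on_set f (X m) \<circ> on_set g (X m)"
  using limit_maps_to[OF assms] by (auto simp: on_set_def fun_eq_iff)

lemma limit_permutes:
  assumes f: "f \<in> limit_group" shows "f permutes limit_set"
proof -
  obtain n where n: "\<And>m. m \<ge> n \<Longrightarrow> on_set f (X m) \<in> \<Gamma> m" using limit_memE[OF f] by blast
  have perm: "on_set f (X m) permutes X m" if "m \<ge> n" for m
    using sharp_perm_group.permutes[OF sharp_group n[OF that]] .
  have "inj_on f limit_set"
  proof (rule inj_onI)
    fix x y assume xy: "x \<in> limit_set" "y \<in> limit_set" "f x = f y"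
    obtain m where m: "m \<ge> n" "x \<in> X m" using eventually_in_X[OF xy(1)] .
    obtain k where k: "k \<ge> m" "y \<in> X k" using eventually_in_X[OF xy(2)] .
    then have "x \<in> X k" "k \<ge> n" using m X_mono[of m k] by auto
    then have "on_set f (X k) x = on_set f (X k) y" using k xy on_set_eq by simp
    then show "x = y" using permutes_inj[OF perm[OF \<open>k \<ge> n\<close>]] by (auto dest: injD)
  qed
  moreover have "f ` limit_set = limit_set"
  proof
    show "f ` limit_set \<subseteq> limit_set"
    proof
      fix y assume "y \<in> f ` limit_set"
      then obtain x where x: "x \<in> limit_set" "y = f x" by blast
      obtain m where m: "m \<ge> n" "x \<in> X m" using eventually_in_X[OF x(1)] .
      then show "y \<in> limit_set" using limit_maps_to[OF n[OF m(1)] m(2)] x X_limit by simp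
    qed
    show "limit_set \<subseteq> f ` limit_set"
    proof
      fix y assume y: "y \<in> limit_set"
      obtain m where m: "m \<ge> n" "y \<in> X m" using eventually_in_X[OF y] .
      then have "y \<in> on_set f (X m) ` X m" using permutes_image[OF perm[OF m(1)]] by simp
      then obtain x where "x \<in> X m" "y = f x" by (auto simp: on_set_eq)
      then show "y \<in> f ` limit_set" using X_limit by blast
    qed
  qed
  ultimately have "bij_betw f limit_set limit_set" by (simp add: bij_betw_def)
  then show ?thesis using f by (intro bij_imp_permutes) (auto simp: limit_group_def)
qed

lemma on_set_pinv:
  assumes f: "f \<in> limit_group" and m: "on_set f (X m) \<in> \<Gamma> m"
  shows "on_set (pinv f) (X m) = pinv (on_set f (X m))"
proof -
  have inv: "pinv f (f x) = x" "f (pinv f x) = x" for x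
    using permutes_inverses[OF limit_permutes[OF f]] by auto
  have maps: "pinv f y \<in> X m" if y: "y \<in> X m" for y
  proof -
    have "y \<in> on_set f (X m) ` X m"
      using permutes_image[OF sharp_perm_group.permutes[OF sharp_group m]] y by simp
    then obtain x where "x \<in> X m" "y = f x" by (auto simp: on_set_eq)
    then show ?thesis using inv by simp
  qed
  have "pinv (on_set f (X m)) = on_set (pinv f) (X m)"
    using inv maps limit_maps_to[OF m]
    by (intro inv_unique_comp) (auto simp: on_set_def fun_eq_iff)
  then show ?thesis by simp
qed

text \<open>
  Every clause concerns finitely many elements and points, so it is inherited from the late stages.
\<close>

theorem limit_sharp: "sharp_perm_group limit_set limit_group"
proof
  fix f assume f: "f \<in> limit_group"
  obtain n where n: "\<And>m. m \<ge> n \<Longrightarrow> on_set f (X m) \<in> \<Gamma> m" using limit_memE[OF f] by blast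
  show perm: "f permutes limit_set" by (rule limit_permutes[OF f])
  have "\<forall>x. x \<notin> limit_set \<longrightarrow> pinv f x = x"
    using permutes_inv[OF perm] by (simp add: permutes_def)
  moreover have "on_set (pinv f) (X m) \<in> \<Gamma> m" if "m \<ge> n" for m
    using on_set_pinv[OF f n[OF that]] sharp_perm_group.pinv_mem[OF sharp_group n[OF that]] by simp
  ultimately show "pinv f \<in> limit_group" unfolding limit_group_def by blast
  show "f \<circ> g \<in> limit_group" if g: "g \<in> limit_group" for g
  proof -
    obtain k where k: "\<And>m. m \<ge> k \<Longrightarrow> on_set g (X m) \<in> \<Gamma> m" using limit_memE[OF g] by blast
    have "on_set (f \<circ> g) (X m) \<in> \<Gamma> m" if "m \<ge> max n k" for m
      using on_set_comp[OF k] sharp_perm_group.comp_mem[OF sharp_group n k] that by simp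
    moreover have "\<forall>x. x \<notin> limit_set \<longrightarrow> (f \<circ> g) x = x" using f g by (simp add: limit_group_def)
    ultimately show ?thesis unfolding limit_group_def by blast
  qed
  show "f = id" if xy: "x \<in> limit_set" "y \<in> limit_set" "x \<noteq> y" "f x = x" "f y = y" for x y
  proof -
    obtain i where i: "i \<ge> n" "x \<in> X i" using eventually_in_X[OF xy(1)] .
    obtain j where j: "j \<ge> i" "y \<in> X j" using eventually_in_X[OF xy(2)] .
    show ?thesis
    proof (rule limit_eq_idI[OF f])
      fix m assume m: "m \<ge> j"
      have "x \<in> X m" "y \<in> X m" using i j m X_mono[of i m] X_mono[of j m] by auto
      then show "on_set f (X m) = id"
        using sharp_perm_group.sharp[OF sharp_group n, of m x y] xy i j m by (simp add: on_set_eq)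
    qed
  qed
  show "f = id" if inv: "f \<circ> f = id" and x: "x \<in> limit_set" "f x = x" for x
  proof -
    obtain i where i: "i \<ge> n" "x \<in> X i" using eventually_in_X[OF x(1)] .
    show ?thesis
    proof (rule limit_eq_idI[OF f])
      fix m assume m: "m \<ge> i"
      then have mem: "x \<in> X m" "on_set f (X m) \<in> \<Gamma> m" using i X_mono[of i m] n by auto
      have "on_set f (X m) \<circ> on_set f (X m) = on_set id (X m)"
        using on_set_comp[OF mem(2), of f] inv by simp
      also have "\<dots> = id" by (simp add: on_set_def fun_eq_iff)
      finally show "on_set f (X m) = id"
        using sharp_perm_group.involution_free[OF sharp_group mem(2)] mem x by (simp add: on_set_eq)
    qed
  qed
next
  have "on_set id (X m) = id" for m by (simp add: on_set_def fun_eq_iff)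
  then show "id \<in> limit_group"
    using sharp_perm_group.id_mem[OF sharp_group] by (simp add: limit_group_def)
qed

text \<open>
  The lifts of an element to the later stages are unique and hence compatible, so they can be
  glued together.
\<close>

theorem limit_extends: "extends (X n) (\<Gamma> n) limit_set limit_group"
proof -
  have "\<exists>f\<in>limit_group. \<forall>x\<in>X n. f x = g x" if g: "g \<in> \<Gamma> n" for g
  proof -
    have "\<forall>m\<ge>n. \<exists>k. k \<in> \<Gamma> m \<and> (\<forall>x\<in>X n. k x = g x)"
      using extends_le[of n] g unfolding extends_def by blast
    then obtain G where G: "\<And>m. m \<ge> n \<Longrightarrow> G m \<in> \<Gamma> m"
      "\<And>m x. m \<ge> n \<Longrightarrow> x \<in> X n \<Longrightarrow> G m x = g x" by metis
    have coherent: "G m x = G k x" if km: "n \<le> k" "k \<le> m" and x: "x \<in> X k" for m k x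
    proof -
      obtain h where h: "h \<in> \<Gamma> m" "\<And>x. x \<in> X k \<Longrightarrow> h x = G k x"
        using extends_le[OF km(2)] G(1)[OF km(1)] by (auto simp: extends_def)
      have "h = G m"
        by (rule sharp_perm_group.eq_if_agree[OF sharp_group, of _ m _ x0 y0])
          (use h G km base in simp_all)
      then show ?thesis using h x by simp
    qed
    define f where "f x = (if x \<in> limit_set then G (max n (LEAST j. x \<in> X j)) x else x)" for x
    have f: "f x = G m x" if "m \<ge> n" "x \<in> X m" for m x
    proof -
      define j where "j = max n (LEAST j. x \<in> X j)"
      have j: "n \<le> j" "j \<le> m" using Least_le[of "\<lambda>j. x \<in> X j" m] that by (auto simp: j_def)
      have "x \<in> X (LEAST j. x \<in> X j)" using LeastI[of "\<lambda>j. x \<in> X j" m] that by simp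
      then have "x \<in> X j" using X_mono[of "LEAST j. x \<in> X j" j] by (auto simp: j_def)
      then show ?thesis using coherent[OF j] X_limit that by (simp add: f_def flip: j_def)
    qed
    have "on_set f (X m) = G m" if "m \<ge> n" for m
      using f[OF that] sharp_perm_group.permutes[OF sharp_group G(1)[OF that]]
      by (auto simp: on_set_def fun_eq_iff permutes_def)
    then have "\<forall>m\<ge>n. on_set f (X m) \<in> \<Gamma> m" using G(1) by simp
    moreover have "\<forall>x. x \<notin> limit_set \<longrightarrow> f x = x" by (simp add: f_def)
    ultimately have "f \<in> limit_group" unfolding limit_group_def by blast
    then show ?thesis using f[of n] G(2)[of n] by auto
  qed
  then show ?thesis using X_limit by (auto simp: extends_def)
qed

end

section \<open>The simple group\<close>

text \<open>
  The base points are 0 and 1. The infinite complement is the room for further points.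
\<close>

definition admissible :: "nat set \<times> (nat \<Rightarrow> nat) set \<Rightarrow> bool" where
  "admissible S \<longleftrightarrow> sharp_perm_group (fst S) (snd S) \<and> infinite (fst S) \<and> infinite (- fst S) \<and>
     0 \<in> fst S \<and> (\<exists>t\<in>snd S. t 0 = 1 \<and> t 1 = 0)"

text \<open>
  By sharpness an element is determined by the images of 0 and 1, so quadruples of natural
  numbers name all pairs of elements at every stage of the construction, and the list of demands
  does not depend on the stage. A quadruple is settled once both elements exist and the first is
  trivial or derives the second.
\<close>

definition solves :: "(nat \<Rightarrow> nat) set \<Rightarrow> nat \<times> nat \<times> nat \<times> nat \<Rightarrow> bool" where
  "solves \<Gamma> = (\<lambda>(a, b, c, d). \<exists>g\<in>\<Gamma>. \<exists>h\<in>\<Gamma>. g 0 = a \<and> g 1 = b \<and> h 0 = c \<and> h 1 = d \<and>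
     (g = id \<or> derives \<Gamma> g h))"

definition task_in :: "nat set \<Rightarrow> nat \<times> nat \<times> nat \<times> nat \<Rightarrow> bool" where
  "task_in X = (\<lambda>(a, b, c, d). a \<in> X \<and> b \<in> X \<and> c \<in> X \<and> d \<in> X \<and> a \<noteq> b \<and> c \<noteq> d)"

lemma admissible_extension:
  assumes adm: "admissible (X, \<Gamma>)" and G': "sharp_perm_group X' \<Gamma>'" "infinite (- X')"
    and sub: "X \<subseteq> X'" and L: "lifts X \<Gamma> \<Gamma>' L"
  shows "admissible (X', \<Gamma>')" and "extends X \<Gamma> X' \<Gamma>'"
proof -
  obtain t where t: "t \<in> \<Gamma>" "t 0 = 1" "t 1 = 0" using adm by (auto simp: admissible_def)
  have X: "0 \<in> X" "infinite X" "sharp_perm_group X \<Gamma>" using adm by (auto simp: admissible_def)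
  then have "1 \<in> X" using sharp_perm_group.maps_to[OF X(3) t(1) X(1)] t by simp
  then have "L t 0 = 1" "L t 1 = 0" using t X lifts_eq[OF L] by auto
  then show "admissible (X', \<Gamma>')"
    using G' sub X lifts_mem[OF L t(1)] by (auto simp: admissible_def dest: infinite_super)
  show "extends X \<Gamma> X' \<Gamma>'" using sub L extends_iff_lifts by blast
qed

lemma adjoin_admissible_transporter:
  assumes adm: "admissible (X, \<Gamma>)" and ab: "a \<in> X" "b \<in> X" "a \<noteq> b"
  shows "\<exists>X' \<Gamma>'. admissible (X', \<Gamma>') \<and> extends X \<Gamma> X' \<Gamma>' \<and> (\<exists>g\<in>\<Gamma>'. g 0 = a \<and> g 1 = b)"
proof (cases "\<exists>g\<in>\<Gamma>. g 0 = a \<and> g 1 = b")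
  case True
  then show ?thesis using adm extends_refl by blast
next
  case False
  interpret sharp_perm_group X \<Gamma> using adm by (simp add: admissible_def)
  obtain t where t: "t \<in> \<Gamma>" "t 0 = 1" "t 1 = 0" using adm by (auto simp: admissible_def)
  have "0 \<in> X" "infinite (- X)" using adm by (auto simp: admissible_def)
  then show ?thesis
  proof (rule_tac adjoin_transporter[OF _ _ t(1), of 0 1 a b])
    fix X' \<Gamma>' \<zeta> L
    assume "sharp_perm_group X' \<Gamma>'" "infinite (- X')" "X \<subseteq> X'" "lifts X \<Gamma> \<Gamma>' L"
      "\<zeta> \<in> \<Gamma>'" "\<zeta> 0 = a" "\<zeta> 1 = b"
    then show ?thesis using admissible_extension[OF adm] by blast
  qed (use t ab False in auto)
qed

lemma solve_task:
  assumes adm: "admissible (X, \<Gamma>)" and task: "task_in X (a, b, c, d)"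
  shows "\<exists>X' \<Gamma>'. admissible (X', \<Gamma>') \<and> extends X \<Gamma> X' \<Gamma>' \<and> solves \<Gamma>' (a, b, c, d)"
proof -
  obtain X1 \<Gamma>1 g where 1: "admissible (X1, \<Gamma>1)" "extends X \<Gamma> X1 \<Gamma>1" "g \<in> \<Gamma>1" "g 0 = a" "g 1 = b"
    using adjoin_admissible_transporter[OF adm, of a b] task by (auto simp: task_in_def)
  have "c \<in> X1" "d \<in> X1" "c \<noteq> d" using 1(2) task by (auto simp: task_in_def extends_def)
  then obtain X2 \<Gamma>2 h where 2: "admissible (X2, \<Gamma>2)" "extends X1 \<Gamma>1 X2 \<Gamma>2" "h \<in> \<Gamma>2" "h 0 = c" "h 1 = d"
    using adjoin_admissible_transporter[OF 1(1), of c d] by blast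
  interpret G2: sharp_perm_group X2 \<Gamma>2 using 2 by (simp add: admissible_def)
  interpret G1: sharp_perm_group X1 \<Gamma>1 using 1 by (simp add: admissible_def)
  have base: "0 \<in> X1" "1 \<in> X1" "0 \<in> X2" "1 \<in> X2"
    using 1(1) 2(1) G1.maps_to G2.maps_to by (force simp: admissible_def)+
  obtain g' where "g' \<in> \<Gamma>2" "\<forall>x\<in>X1. g' x = g x" using 2(2) 1(3) by (auto simp: extends_def)
  then have g': "g' \<in> \<Gamma>2" "g' 0 = a" "g' 1 = b" using 1 base by auto
  have ext: "extends X \<Gamma> X2 \<Gamma>2" using 1(2) 2(2) extends_trans by blast
  show ?thesis
  proof (cases "g' = id")
    case True
    then have "solves \<Gamma>2 (a, b, c, d)" unfolding solves_def prod.case using g' 2(3-5) by blast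
    then show ?thesis using 2 ext by blast
  next
    case False
    have "infinite (- X2)" using 2 by (simp add: admissible_def)
    then show ?thesis
    proof (rule_tac G2.adjoin_derivation[of 0 1 g' h])
      fix X3 \<Gamma>3 L
      assume 8: "sharp_perm_group X3 \<Gamma>3" "infinite (- X3)" "X2 \<subseteq> X3" "lifts X2 \<Gamma>2 \<Gamma>3 L"
        "derives \<Gamma>3 (L g') (L h)"
      have "L g' \<in> \<Gamma>3" "L h \<in> \<Gamma>3" "L g' 0 = a" "L g' 1 = b" "L h 0 = c" "L h 1 = d"
        
        using lifts_mem[OF 8(4)] lifts_eq[OF 8(4)] g' 2(3-5) base by auto
      then have "solves \<Gamma>3 (a, b, c, d)" unfolding solves_def prod.case using 8(5) by blast
      then show ?thesis
        using admissible_extension[OF 2(1) 8(1-4)] extends_trans[OF ext] by blast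
    qed (use base g' 2(3) False in simp_all)
  qed
qed

lemma solves_extension:
  assumes "sharp_perm_group X \<Gamma>" "sharp_perm_group X' \<Gamma>'" "extends X \<Gamma> X' \<Gamma>'" "0 \<in> X" "1 \<in> X"
    and sol: "solves \<Gamma> \<tau>"
  shows "solves \<Gamma>' \<tau>"
proof -
  obtain a b c d where \<tau>: "\<tau> = (a, b, c, d)" by (cases \<tau>)
  obtain L where L: "lifts X \<Gamma> \<Gamma>' L" and sub: "X \<subseteq> X'" using assms(3) unfolding extends_iff_lifts by blast
  obtain g h where gh: "g \<in> \<Gamma>" "h \<in> \<Gamma>" "g 0 = a" "g 1 = b" "h 0 = c" "h 1 = d"
    and der: "g = id \<or> derives \<Gamma> g h" using sol by (auto simp: solves_def \<tau>)
  have two: "(0 :: nat) \<noteq> 1" by simp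
  have "L g = id" if "g = id"
  proof -
    have "L g 0 = 0" "L g 1 = 1" using lifts_eq[OF L gh(1)] that assms(4,5) by simp_all
    then show ?thesis
      by (rule sharp_perm_group.sharp[OF assms(2) lifts_mem[OF L gh(1)]
            subsetD[OF sub assms(4)] subsetD[OF sub assms(5)] two])
  qed
  moreover have "derives \<Gamma>' (L g) (L h)" if "derives \<Gamma> g h"
    using sharp_perm_group.derives_lift[OF assms(1,2) sub assms(4,5) two L gh(1,2) that] .
  moreover have "L g \<in> \<Gamma>'" "L h \<in> \<Gamma>'" "L g 0 = a" "L g 1 = b" "L h 0 = c" "L h 1 = d"
    using gh assms(4,5) by (simp_all add: lifts_mem[OF L] lifts_eq[OF L])
  ultimately show ?thesis using der unfolding solves_def \<tau> by blast
qed

text \<open>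
  The group of order 2 acting freely on an infinite set: \<open>t\<close> swaps \<open>4k\<close> and \<open>4k + 1\<close> and
  leaves the numbers congruent to 2 or 3 modulo 4 unused.
\<close>

lemma initial_admissible: "\<exists>S. admissible S"
proof -
  define X :: "nat set" where "X = {n. even (n div 2)}"
  define t :: "nat \<Rightarrow> nat" where
    "t n = (if even (n div 2) then (if even n then Suc n else n - 1) else n)" for n
  have t_even: "t (2 * m) = (if even m then Suc (2 * m) else 2 * m)" for m by (simp add: t_def)
  have t_odd: "t (Suc (2 * m)) = (if even m then 2 * m else Suc (2 * m))" for m by (simp add: t_def)
  have X_even: "2 * m \<in> X \<longleftrightarrow> even m" and X_odd: "Suc (2 * m) \<in> X \<longleftrightarrow> even m" for m
    by (simp_all add: X_def)
  have parity: "(\<exists>m. n = 2 * m) \<or> (\<exists>m. n = Suc (2 * m))" for n :: nat by presburger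
  have tt: "t \<circ> t = id"
  proof
    fix n show "(t \<circ> t) n = id n"
      using parity[of n] by (auto simp: t_even t_odd)
  qed
  have moves: "t n \<noteq> n" if "n \<in> X" for n
    using parity[of n] that by (auto simp: t_even t_odd X_even X_odd)
  have tX: "t n \<in> X \<longleftrightarrow> n \<in> X" for n
    using parity[of n] by (auto simp: t_even t_odd X_even X_odd split: if_splits)
  have "bij_betw t X X"
    using tX tt by (intro bij_betw_byWitness[of _ t]) (auto simp: fun_eq_iff)
  moreover have "t n = n" if "n \<notin> X" for n using that by (simp add: X_def t_def)
  ultimately have perm: "t permutes X" by (rule bij_imp_permutes)
  have pinv_t: "pinv t = t" using tt by (intro inv_unique_comp)
  have pinv_id: "pinv id = (id :: nat \<Rightarrow> nat)" by (intro inv_unique_comp) auto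
  have "sharp_perm_group X {id, t}"
    by unfold_locales (use perm tt moves pinv_t pinv_id permutes_id in auto)
  moreover have "infinite X"
  proof -
    have "2 * (2 * n) \<in> X" for n by (subst X_even) simp
    then have "range (\<lambda>n. 2 * (2 * n)) \<subseteq> X" by blast
    moreover have "inj (\<lambda>n::nat. 2 * (2 * n))" by (auto simp: inj_def)
    ultimately show ?thesis using range_inj_infinite infinite_super by blast
  qed
  moreover have "infinite (- X)"
  proof -
    have "2 * Suc (2 * n) \<notin> X" for n by (subst X_even) simp
    then have "range (\<lambda>n. 2 * Suc (2 * n)) \<subseteq> - X" by blast
    moreover have "inj (\<lambda>n::nat. 2 * Suc (2 * n))" by (auto simp: inj_def)
    ultimately show ?thesis using range_inj_infinite infinite_super by blast
  qed
  moreover have "0 \<in> X" "t 0 = 1" "t 1 = 0" by (simp_all add: X_def t_def)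
  ultimately show ?thesis by (intro exI[of _ "(X, {id, t})"]) (simp add: admissible_def)
qed

text \<open>
  Enumerates all quadruples, each of them infinitely often: a demand can only be met once the points
  it mentions are present.
\<close>

definition task :: "nat \<Rightarrow> nat \<times> nat \<times> nat \<times> nat" where
  "task k = from_nat (fst (prod_decode k))"

lemma task_recurs: "\<exists>k\<ge>n. task k = \<tau>"
  by (rule exI[of _ "prod_encode (to_nat \<tau>, n)"]) (simp add: task_def le_prod_encode_2)

text \<open>
  At stage \<open>n\<close> the demand \<open>task n\<close> is met if its points are present. Every demand about points of the union
  comes up after they are present, and stays met afterwards.
\<close>

theorem saturated_group:
  obtains X :: "nat set" and \<Gamma>
  where "sharp_perm_group X \<Gamma>" "infinite X" "0 \<in> X" "1 \<in> X" "\<And>\<tau>. task_in X \<tau> \<Longrightarrow> solves \<Gamma> \<tau>"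
proof -
  have "\<exists>S. \<forall>n. admissible (S n) \<and>
      (extends (fst (S n)) (snd (S n)) (fst (S (Suc n))) (snd (S (Suc n))) \<and>
        (task_in (fst (S n)) (task n) \<longrightarrow> solves (snd (S (Suc n))) (task n)))"
  proof (rule dependent_nat_choice[of "\<lambda>_. admissible" "\<lambda>n S S'. extends (fst S) (snd S) (fst S') (snd S') \<and>
        (task_in (fst S) (task n) \<longrightarrow> solves (snd S') (task n))"])
    show "\<exists>S. admissible S" by (rule initial_admissible)
    fix S n assume S: "admissible S"
    show "\<exists>S'. admissible S' \<and> extends (fst S) (snd S) (fst S') (snd S') \<and>
        (task_in (fst S) (task n) \<longrightarrow> solves (snd S') (task n))"
    proof (cases "task_in (fst S) (task n)")
      case True
      obtain a b c d where "task n = (a, b, c, d)" by (cases "task n")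
      then show ?thesis using solve_task[of "fst S" "snd S" a b c d] S True by auto
    next
      case False
      then show ?thesis using S extends_refl by blast
    qed
  qed
  then obtain S where adm: "\<And>n. admissible (S n)"
    and ext: "\<And>n. extends (fst (S n)) (snd (S n)) (fst (S (Suc n))) (snd (S (Suc n)))"
    and sol: "\<And>n. task_in (fst (S n)) (task n) \<Longrightarrow> solves (snd (S (Suc n))) (task n)"
    by blast
  define X where "X n = fst (S n)" for n
  define \<Gamma> where "\<Gamma> n = snd (S n)" for n
  have G: "sharp_perm_group (X n) (\<Gamma> n)" "0 \<in> X n" for n
    using adm[of n] by (auto simp: admissible_def X_def \<Gamma>_def)
  have one: "1 \<in> X n" for n
  proof -
    obtain t where "t \<in> \<Gamma> n" "t 0 = 1" using adm[of n] by (auto simp: admissible_def \<Gamma>_def)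
    then show ?thesis using sharp_perm_group.maps_to[OF G(1), of t n 0] G(2) by simp
  qed
  interpret sharp_chain X \<Gamma> 0 1
    by (rule sharp_chain.intro) (use G one ext in \<open>simp_all add: X_def \<Gamma>_def\<close>)
  show thesis
  proof (rule that[OF limit_sharp])
    show "infinite limit_set"
      using adm[of 0] X_limit[of _ 0] by (auto simp: admissible_def X_def dest: infinite_super[OF subsetI])
    show "0 \<in> limit_set" "1 \<in> limit_set" using X_limit G(2) one by blast+
    fix \<tau> assume \<tau>: "task_in limit_set \<tau>"
    obtain a b c d where abcd: "\<tau> = (a, b, c, d)" by (cases \<tau>)
    have in4: "a \<in> limit_set" "b \<in> limit_set" "c \<in> limit_set" "d \<in> limit_set"
      using \<tau> by (auto simp: abcd task_in_def)
    obtain i where i: "a \<in> X i" using eventually_in_X[OF in4(1), of 0] by blast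
    obtain j where j: "j \<ge> i" "b \<in> X j" using eventually_in_X[OF in4(2)] .
    obtain k where k: "k \<ge> j" "c \<in> X k" using eventually_in_X[OF in4(3)] .
    obtain l where l: "l \<ge> k" "d \<in> X l" using eventually_in_X[OF in4(4)] .
    \<comment> \<open>At this stage all four points are present.\<close>
    obtain n where n: "n \<ge> l" "task n = \<tau>" using task_recurs by blast
    have "a \<in> X n" "b \<in> X n" "c \<in> X n" "d \<in> X n"
      using i j k l n X_mono[of i n] X_mono[of j n] X_mono[of k n] X_mono[of l n] by auto
    then have "task_in (fst (S n)) (task n)" using \<tau> n by (simp add: abcd task_in_def X_def)
    then have "solves (\<Gamma> (Suc n)) \<tau>" using sol[of n] n(2) by (simp add: \<Gamma>_def)
    then show "solves limit_group \<tau>"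
      using solves_extension[OF G(1) limit_sharp limit_extends G(2) one] by blast
  qed
qed

lemma derives_in_normal:
  assumes G: "sharp_perm_group X \<Gamma>" and N: "N \<lhd> perm_group \<Gamma>"
    and g: "g \<in> N" and h: "h \<in> \<Gamma>" and der: "derives \<Gamma> g h"
  shows "h \<in> N"
proof (cases "h = g")
  case False
  interpret sharp_perm_group X \<Gamma> by (rule G)
  have sub: "subgroup N (perm_group \<Gamma>)" using N by (rule normal_imp_subgroup)
  have N_mem: "n \<in> \<Gamma>" if "n \<in> N" for n using subgroup.subset[OF sub] that by auto
  have N_comp: "m \<circ> n \<in> N" if "m \<in> N" "n \<in> N" for m n
    using subgroup.m_closed[OF sub] that by simp
  have N_pinv: "pinv n \<in> N" if "n \<in> N" for n
    using subgroup.m_inv_closed[OF sub that] inv_perm_group[OF N_mem[OF that]] by simp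
  have N_conj: "z \<circ> n \<circ> pinv z \<in> N" if "z \<in> \<Gamma>" "n \<in> N" for z n
    using normal.inv_op_closed2[OF N, of z n] that inv_perm_group by simp
  obtain z v where zv: "z \<in> \<Gamma>" "v \<in> \<Gamma>"
    and eq: "v \<circ> (pinv z \<circ> g \<circ> z \<circ> pinv g) = (pinv z \<circ> g \<circ> z \<circ> pinv g) \<circ> h \<circ> v"
    using der False by (auto simp: derives_def)
  define p where "p = pinv z \<circ> g \<circ> z \<circ> pinv g"
  have "pinv z \<circ> g \<circ> pinv (pinv z) \<in> N" using N_conj pinv_mem zv g by blast
  moreover have "pinv (pinv z) = z" using pinv_left pinv_right zv by (intro inv_unique_comp) auto
  ultimately have p: "p \<in> N" unfolding p_def using N_comp N_pinv g by simp
  have "h = pinv p \<circ> (v \<circ> p \<circ> pinv v)"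
  proof
    fix x
    have "v (p (pinv v x)) = p (h (v (pinv v x)))"
      using fun_cong[OF eq, of "pinv v x"] by (simp add: p_def)
    then show "h x = (pinv p \<circ> (v \<circ> p \<circ> pinv v)) x"
      using pinv_right_apply[OF zv(2)] pinv_left_apply[OF N_mem[OF p]] by simp
  qed
  then show ?thesis using N_comp N_pinv N_conj p zv by metis
qed (use g in simp)

theorem theorem1p2:
  shows "\<exists>G :: nat monoid.
    infinite (carrier G) \<and> is_simple_group G \<and> sharply_2_transitive_group G"
proof -
  obtain X :: "nat set" and \<Gamma> where G: "sharp_perm_group X \<Gamma>" and X: "infinite X" "0 \<in> X" "1 \<in> X"
    and sol: "\<And>\<tau>. task_in X \<tau> \<Longrightarrow> solves \<Gamma> \<tau>" by (rule saturated_group) blast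
  interpret sharp_perm_group X \<Gamma> by (rule G)
  have two: "(0 :: nat) \<noteq> 1" by simp
  have from_base: "\<exists>g\<in>\<Gamma>. g 0 = a \<and> g 1 = b" if "a \<in> X" "b \<in> X" "a \<noteq> b" for a b
    using sol[of "(a, b, a, b)"] that by (auto simp: task_in_def solves_def)
  have inf: "infinite \<Gamma>"
  proof
    assume "finite \<Gamma>"
    then have "finite ((\<lambda>g. g 0) ` \<Gamma>)" by simp
    moreover have "X \<subseteq> (\<lambda>g. g 0) ` \<Gamma>"
    proof
      fix a assume "a \<in> X"
      moreover obtain b where "b \<in> X" "b \<noteq> a" using X by (cases "a = 0") auto
      ultimately show "a \<in> (\<lambda>g. g 0) ` \<Gamma>" using from_base[of a b] by auto
    qed
    ultimately show False using X finite_subset by blast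
  qed
  have "is_simple_group (perm_group \<Gamma>)"
    unfolding is_simple_group_def
  proof (intro conjI allI impI)
    show "group (perm_group \<Gamma>)" by (rule group_perm_group)
    show "carrier (perm_group \<Gamma>) \<noteq> {\<one>\<^bsub>perm_group \<Gamma>\<^esub>}" using inf by auto
    fix N assume N: "N \<lhd> perm_group \<Gamma>"
    have sub: "subgroup N (perm_group \<Gamma>)" using N by (rule normal_imp_subgroup)
    then have N\<Gamma>: "N \<subseteq> \<Gamma>" "id \<in> N" using subgroup.subset subgroup.one_closed by fastforce+
    show "N = carrier (perm_group \<Gamma>) \<or> N = {\<one>\<^bsub>perm_group \<Gamma>\<^esub>}"
    proof (cases "N = {id}")
      case False
      then obtain g where g: "g \<in> N" "g \<noteq> id" using N\<Gamma> by blast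
      have g\<Gamma>: "g \<in> \<Gamma>" using g N\<Gamma> by blast
      have "h \<in> N" if h: "h \<in> \<Gamma>" for h
      proof -
        have "task_in X (g 0, g 1, h 0, h 1)"
          using maps_to g\<Gamma> h X inj_mem[OF g\<Gamma>] inj_mem[OF h] two by (simp add: task_in_def)
        \<comment> \<open>\<open>g\<close> and \<open>h\<close> are recovered from the images of the base points.\<close>
        then obtain g' h' where gh': "g' \<in> \<Gamma>" "h' \<in> \<Gamma>" "g' 0 = g 0" "g' 1 = g 1" "h' 0 = h 0" "h' 1 = h 1"
          and "g' = id \<or> derives \<Gamma> g' h'" using sol by (fastforce simp: solves_def)
        moreover have "g' = g" "h' = h"
          using eq_if_agree[OF _ _ X(2,3) two] gh' g\<Gamma> h by auto
        ultimately show ?thesis using derives_in_normal[OF G N g(1) h] g by blast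
      qed
      then show ?thesis using N\<Gamma> by auto
    qed simp
  qed
  moreover have "sharply_2_transitive_action (perm_group \<Gamma>) X (\<lambda>g. restrict g X)"
  proof -
    have Bij: "restrict g X \<in> Bij X" if "g \<in> \<Gamma>" for g
    proof -
      have "bij_betw g X X" using permutes_imp_bij[OF permutes[OF that]] .
      then show ?thesis by (simp add: Bij_def)
    qed
    have "restrict (g \<circ> h) X = compose X (restrict g X) (restrict h X)"
      if "h \<in> \<Gamma>" for h and g :: "nat \<Rightarrow> nat"
      using maps_to[OF that] by (auto simp: compose_def restrict_def)
    then have "group_action (perm_group \<Gamma>) X (\<lambda>g. restrict g X)"
      unfolding group_action_def group_hom_def group_hom_axioms_def hom_def
      using group_perm_group group_BijGroup[of X] Bij by (auto simp: BijGroup_def)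
    moreover have "\<exists>!g. g \<in> carrier (perm_group \<Gamma>) \<and> restrict g X a = c \<and> restrict g X b = d"
      if abcd: "a \<in> X" "b \<in> X" "c \<in> X" "d \<in> X" "a \<noteq> b" "c \<noteq> d" for a b c d
    proof -
      obtain f where f: "f \<in> \<Gamma>" "f 0 = a" "f 1 = b" using from_base abcd by metis
      obtain k where k: "k \<in> \<Gamma>" "k 0 = c" "k 1 = d" using from_base abcd by metis
      have "pinv f a = 0" "pinv f b = 1" using pinv_left_apply[OF f(1)] f by auto
      then have mem: "k \<circ> pinv f \<in> \<Gamma>" "(k \<circ> pinv f) a = c" "(k \<circ> pinv f) b = d"
        using f k by (simp_all add: comp_mem pinv_mem)
      show ?thesis
      proof (rule ex1I[of _ "k \<circ> pinv f"])
        show "k \<circ> pinv f \<in> carrier (perm_group \<Gamma>) \<and>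
            restrict (k \<circ> pinv f) X a = c \<and> restrict (k \<circ> pinv f) X b = d"
          using mem abcd by simp
        fix g assume "g \<in> carrier (perm_group \<Gamma>) \<and> restrict g X a = c \<and> restrict g X b = d"
        then have g: "g \<in> \<Gamma>" "g a = c" "g b = d" using abcd by simp_all
        show "g = k \<circ> pinv f"
          by (rule eq_if_agree[OF g(1) mem(1) abcd(1,2,5)]) (use g mem in simp_all)
      qed
    qed
    ultimately show ?thesis
      using X two by (auto simp: sharply_2_transitive_action_def sharply_2_transitive_action_axioms_def)
  qed
  ultimately show ?thesis
    using nat_carrier_suffices[of "perm_group \<Gamma>"] inf sharply_2_transitive_groupI by auto
qed

end
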